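(* Let $K$ be a field of characteristic zero, $R=K[x,y,z]$, $s\ge 3$, and let $I=(L_1^{a_1},\dots,L_s^{a_s})$, where $L_1,\dots,L_s$ are general linear forms and $a_1,\dots,a_s$ are positive integers. Let $L$ be a general linear form. Then for every integer $j$ the homomorphism $\times L^2:[R/I]_{j-2}\to[R/I]_j$ has maximal rank (i.e. is injective or surjective).
   Context: "General" means in a suitable nonempty Zariski open set. *)

theory Defs
  imports "HOL-Computational_Algebra.Polynomial"
begin

text \<open>The polynomial ring R = K[x,y,z] is modelled as the iterated univariate
polynomial ring K[x][y][z], i.e. the type 'a poly poly poly (outermost variable z).\<close>

type_synonym 'a mpoly3 = "'a poly poly poly"

definition coeff3 :: "'a::zero mpoly3 \<Rightarrow> nat \<Rightarrow> nat \<Rightarrow> nat \<Rightarrow> 'a" where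
  "coeff3 p i j k = coeff (coeff (coeff p k) j) i"

definition const3 :: "'a::zero \<Rightarrow> 'a mpoly3" where
  "const3 c = [:[:[:c:]:]:]"

definition varX :: "'a::comm_ring_1 mpoly3" where "varX = [:[:[:0, 1:]:]:]"
definition varY :: "'a::comm_ring_1 mpoly3" where "varY = [:[:[:0:], [:1:]:]:]"
definition varZ :: "'a::comm_ring_1 mpoly3" where "varZ = [:[:[:0:]:], [:[:1:]:]:]"

definition linform :: "'a::comm_ring_1 \<Rightarrow> 'a \<Rightarrow> 'a \<Rightarrow> 'a mpoly3" where
  "linform u v w = const3 u * varX + const3 v * varY + const3 w * varZ"

text \<open>Graded piece R_d (homogeneous polynomials of degree d, together with 0);
  for d < 0 this is {0}.\<close>
definition hom_part :: "int \<Rightarrow> 'a::zero mpoly3 set" where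
  "hom_part d = {p. \<forall>i j k. coeff3 p i j k \<noteq> 0 \<longrightarrow> int (i + j + k) = d}"

definition gen_ideal :: "nat \<Rightarrow> (nat \<Rightarrow> 'a::comm_ring_1 mpoly3) \<Rightarrow> 'a mpoly3 set" where
  "gen_ideal s G = {\<Sum>i<s. h i * G i | h. True}"

text \<open>Multiplication by F : [R/I]_{j-e} \<rightarrow> [R/I]_j, where [R/I]_d = R_d / (I \<inter> R_d).\<close>
definition mult_injective :: "'a::comm_ring_1 mpoly3 set \<Rightarrow> 'a mpoly3 \<Rightarrow> int \<Rightarrow> int \<Rightarrow> bool" where
  "mult_injective I F e j = (\<forall>f \<in> hom_part (j - e). F * f \<in> I \<longrightarrow> f \<in> I)"

definition mult_surjective :: "'a::comm_ring_1 mpoly3 set \<Rightarrow> 'a mpoly3 \<Rightarrow> int \<Rightarrow> int \<Rightarrow> bool" where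
  "mult_surjective I F e j = (\<forall>g \<in> hom_part j. \<exists>f \<in> hom_part (j - e). g - F * f \<in> I)"

definition max_rank_mult :: "'a::comm_ring_1 mpoly3 set \<Rightarrow> 'a mpoly3 \<Rightarrow> int \<Rightarrow> int \<Rightarrow> bool" where
  "max_rank_mult I F e j = (mult_injective I F e j \<or> mult_surjective I F e j)"

text \<open>Polynomial functions on the affine space K^n (points = lists of length n).\<close>
inductive_set poly_fun :: "nat \<Rightarrow> ('a::comm_ring_1 list \<Rightarrow> 'a) set" for n where
  pf_const: "(\<lambda>xs. c) \<in> poly_fun n"
| pf_coord: "i < n \<Longrightarrow> (\<lambda>xs. xs ! i) \<in> poly_fun n"
| pf_add: "p \<in> poly_fun n \<Longrightarrow> q \<in> poly_fun n \<Longrightarrow> (\<lambda>xs. p xs + q xs) \<in> poly_fun n"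
| pf_mult: "p \<in> poly_fun n \<Longrightarrow> q \<in> poly_fun n \<Longrightarrow> (\<lambda>xs. p xs * q xs) \<in> poly_fun n"

definition zariski_open :: "nat \<Rightarrow> 'a::comm_ring_1 list set \<Rightarrow> bool" where
  "zariski_open n U = (\<exists>P \<subseteq> poly_fun n. U = {xs. length xs = n \<and> (\<exists>p\<in>P. p xs \<noteq> 0)})"

definition lin_of :: "'a::comm_ring_1 list \<Rightarrow> nat \<Rightarrow> 'a mpoly3" where
  "lin_of xs i = linform (xs ! (3*i)) (xs ! (3*i+1)) (xs ! (3*i+2))"

end

theory Submission
  imports Defs
begin

text \<open>If $L^2 f = \sum h_i L_i^{a_i}$ in degree $j$, reduction modulo $L^2$ gives a syzygy over
$R/L^2$. So it suffices that $\bigoplus_i [R/L^2]_{j-a_i} \to [R/L^2]_j$, $(h_i) \mapsto \sum h_i L_i^{a_i}$,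
has maximal rank: if it is onto, then so is multiplication by $L^2$; if it is injective, then every
$h_i$ is a multiple of $L^2$, whence $f \in I$. Being of maximal rank is an open condition, so
one point of the parameter space that is good for all $j$ is enough. Only finitely many $j$ matter, because
surjectivity in one degree propagates upwards.

Take $L = z$ and $L_i = x + t_i y + c_i z$. A functional $u$ killing $z^2 R$ and
all $L_i^{a_i} R$ in degree $j$ is encoded by $f(T) + c\,g(T) = u((x + Ty + cz)^j)$. Expanding around
$L_i$ shows that $(T - t_i)^{b_i}$ divides $f + c_i g$ and $(T - t_i)^{b_i - 1}$ divides $g$, where
$b_i = j - a_i + 1$. After division by $\prod (T - t_i)^{b_i - 1}$ only the conditions
$f(t_i) + c_i g(t_i) = 0$ remain, and for $t_i = 2^i$, $c_i = 3^i$ they form a Vandermonde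
system with the distinct nodes $2^e$ and $3 \cdot 2^e$. Hence $u = 0$ as soon as
$\sum (2 b_i - 1) \ge 2 j + 1 = \dim [R/L^2]_j$. If the sum is smaller, additional forms with $b_i = 1$ make
the matrix square, hence invertible, and its columns independent.\<close>

section \<open>Matrices of full rank\<close>

text \<open>Full row rank for rows \<open>S\<close> and columns \<open>T\<close>; arbitrary index
  types let monomials and tagged monomials serve as indices.\<close>

definition rows_indep :: "'r set \<Rightarrow> 'c set \<Rightarrow> ('r \<Rightarrow> 'c \<Rightarrow> 'a::field) \<Rightarrow> bool" where
  "rows_indep S T M \<longleftrightarrow> (\<forall>u. (\<forall>t\<in>T. (\<Sum>s\<in>S. u s * M s t) = 0) \<longrightarrow> (\<forall>s\<in>S. u s = 0))"

lemma rows_indepI: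
  assumes "\<And>u s. (\<And>t. t \<in> T \<Longrightarrow> (\<Sum>s\<in>S. u s * M s t) = 0) \<Longrightarrow> s \<in> S \<Longrightarrow> u s = 0"
  shows "rows_indep S T M"
  using assms unfolding rows_indep_def by blast

lemma rows_indepD:
  assumes "rows_indep S T M" "\<And>t. t \<in> T \<Longrightarrow> (\<Sum>s\<in>S. u s * M s t) = 0" "s \<in> S"
  shows "u s = 0"
  using assms unfolding rows_indep_def by blast

lemma rows_indep_pivot:
  assumes "rows_indep (insert s0 S) T M" "finite S" "s0 \<notin> S"
  obtains t0 where "t0 \<in> T" "M s0 t0 \<noteq> 0"
proof (rule ccontr)
  assume "\<not> thesis"
  with that have z: "\<And>t. t \<in> T \<Longrightarrow> M s0 t = 0" by blast
  have "(\<Sum>s\<in>insert s0 S. (if s = s0 then 1 else 0) * M s t) = 0" if "t \<in> T" for t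
  proof -
    have "(\<Sum>s\<in>insert s0 S. (if s = s0 then 1 else 0) * M s t) = (\<Sum>s\<in>insert s0 S. 0)"
      by (rule sum.cong) (use z that in auto)
    thus ?thesis by simp
  qed
  from rows_indepD[where s = s0, OF assms(1) this] show False by simp
qed

text \<open>One fraction-free elimination step: without division, entries that are polynomial in
  parameters stay polynomial.\<close>

definition elim_row :: "'r \<Rightarrow> 'c \<Rightarrow> ('r \<Rightarrow> 'c \<Rightarrow> 'a::field) \<Rightarrow> 'r \<Rightarrow> 'c \<Rightarrow> 'a" where
  "elim_row s0 t0 M s t = M s0 t0 * M s t - M s t0 * M s0 t"

lemma sum_elim_row:
  "(\<Sum>s\<in>S. u s * elim_row s0 t0 M s t) = M s0 t0 * (\<Sum>s\<in>S. u s * M s t) - (\<Sum>s\<in>S. u s * M s t0) * M s0 t"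
  by (simp add: elim_row_def algebra_simps sum_subtractf sum_distrib_left sum_distrib_right)

text \<open>A relation among all rows vanishes in column \<open>t0\<close>, which fixes the
  coefficient of row \<open>s0\<close>; the other coefficients form a relation among the eliminated
  rows, and conversely.\<close>

lemma rows_indep_elim_row:
  assumes "M s0 t0 \<noteq> 0" "finite S" "s0 \<notin> S" "t0 \<in> T"
  shows "rows_indep (insert s0 S) T M \<longleftrightarrow> rows_indep S (T - {t0}) (elim_row s0 t0 M)"
proof
  assume ind: "rows_indep (insert s0 S) T M"
  show "rows_indep S (T - {t0}) (elim_row s0 t0 M)"
  proof (rule rows_indepI)
    fix u s assume u: "\<And>t. t \<in> T - {t0} \<Longrightarrow> (\<Sum>s\<in>S. u s * elim_row s0 t0 M s t) = 0" and s: "s \<in> S"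
    \<comment> \<open>Lift of the relation \<open>u\<close>: scaling by the pivot avoids division,
      and the coefficient at \<open>s0\<close> collects the multiples of row \<open>s0\<close>
      subtracted in the elimination.\<close>
    define v where "v s = (if s = s0 then - (\<Sum>s\<in>S. u s * M s t0) else M s0 t0 * u s)" for s
    have "(\<Sum>s\<in>insert s0 S. v s * M s t) = 0" if "t \<in> T" for t
    proof -
      have eq: "(\<Sum>s\<in>S. v s * M s t) = M s0 t0 * (\<Sum>s\<in>S. u s * M s t)"
        unfolding sum_distrib_left by (rule sum.cong) (use assms in \<open>auto simp: v_def\<close>)
      have "(\<Sum>s\<in>insert s0 S. v s * M s t) = (\<Sum>s\<in>S. u s * elim_row s0 t0 M s t)"
        using assms by (simp add: eq sum_elim_row) (simp add: v_def)
      also have "\<dots> = 0"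
        using u[of t] that by (cases "t = t0") (auto simp: elim_row_def)
      finally show ?thesis .
    qed
    from rows_indepD[where s = s, OF ind this] s have "v s = 0" by simp
    with s assms show "u s = 0" by (auto simp: v_def split: if_splits)
  qed
next
  assume ind: "rows_indep S (T - {t0}) (elim_row s0 t0 M)"
  show "rows_indep (insert s0 S) T M"
  proof (rule rows_indepI)
    fix u s assume u: "\<And>t. t \<in> T \<Longrightarrow> (\<Sum>s\<in>insert s0 S. u s * M s t) = 0" and s: "s \<in> insert s0 S"
    have u': "(\<Sum>s\<in>S. u s * M s t) = - u s0 * M s0 t" if "t \<in> T" for t
      using u[OF that] assms by (simp add: add_eq_0_iff)
    have "(\<Sum>s\<in>S. u s * elim_row s0 t0 M s t) = 0" if "t \<in> T - {t0}" for t
      using that assms by (simp add: sum_elim_row u')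
    from rows_indepD[OF ind this] have z: "u s = 0" if "s \<in> S" for s using that by blast
    with u'[OF assms(4)] have "u s0 = 0" using assms by simp
    with z s show "u s = 0" by auto
  qed
qed

text \<open>Gaussian elimination: solve the eliminated system in the columns other than
  \<open>t0\<close>, then back-substitute.\<close>

lemma rows_indep_solve:
  assumes "finite S" "finite T" "rows_indep S T M"
  shows "\<exists>v. \<forall>s\<in>S. (\<Sum>t\<in>T. M s t * v t) = w s"
  using assms
proof (induction S arbitrary: T M w rule: finite_induct)
  case empty
  show ?case by simp
next
  case (insert s0 S)
  obtain t0 where t0: "t0 \<in> T" "M s0 t0 \<noteq> 0"
    using rows_indep_pivot insert by metis
  define T' where "T' = T - {t0}"
  have T: "T = insert t0 T'" "t0 \<notin> T'" "finite T'" using t0 insert by (auto simp: T'_def)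
  have "rows_indep S T' (elim_row s0 t0 M)"
    using rows_indep_elim_row t0 insert unfolding T'_def by metis
  from insert.IH[OF T(3) this, of "\<lambda>s. M s0 t0 * w s - M s t0 * w s0"]
  obtain v where v: "\<And>s. s \<in> S \<Longrightarrow> (\<Sum>t\<in>T'. elim_row s0 t0 M s t * v t) = M s0 t0 * w s - M s t0 * w s0"
    by blast
  \<comment> \<open>The value at \<open>t0\<close> is forced by the equation of row
    \<open>s0\<close>.\<close>
  define v' where "v' = v(t0 := (w s0 - (\<Sum>t\<in>T'. M s0 t * v t)) / M s0 t0)"
  have 1: "(\<Sum>t\<in>T. M s t * v' t) = M s t0 * v' t0 + (\<Sum>t\<in>T'. M s t * v t)" for s
  proof -
    have "(\<Sum>t\<in>T'. M s t * v' t) = (\<Sum>t\<in>T'. M s t * v t)"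
      by (rule sum.cong) (use T in \<open>auto simp: v'_def\<close>)
    thus ?thesis using T by simp
  qed
  have 2: "(\<Sum>t\<in>T. M s0 t * v' t) = w s0"
    unfolding 1 using t0 by (simp add: v'_def)
  have "(\<Sum>t\<in>T. M s t * v' t) = w s" if "s \<in> S" for s
  proof -
    have "M s0 t0 * (\<Sum>t\<in>T'. M s t * v t) = M s0 t0 * w s - M s t0 * w s0 + M s t0 * (\<Sum>t\<in>T'. M s0 t * v t)"
      using v[OF that] by (simp add: elim_row_def algebra_simps sum_subtractf sum_distrib_left)
    hence "M s0 t0 * (\<Sum>t\<in>T. M s t * v' t) = M s0 t0 * w s"
      unfolding 1 using t0 by (simp add: v'_def field_simps)
    thus ?thesis using t0 by simp
  qed
  with 2 show ?case by (intro exI[of _ v']) auto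
qed

text \<open>Independent rows number at most \<open>card T\<close>, so the cardinality bound makes
  the matrix square. Elimination at a pivot commutes with transposition, which carries the
  induction.\<close>

lemma rows_indep_transpose:
  assumes "finite S" "finite T" "rows_indep S T M" "card T \<le> card S"
  shows "rows_indep T S (\<lambda>t s. M s t)"
  using assms
proof (induction S arbitrary: T M rule: finite_induct)
  case empty
  thus ?case by (simp add: rows_indep_def)
next
  case (insert s0 S)
  obtain t0 where t0: "t0 \<in> T" "M s0 t0 \<noteq> 0"
    using rows_indep_pivot insert by metis
  define T' where "T' = T - {t0}"
  have T: "T = insert t0 T'" "t0 \<notin> T'" "finite T'" using t0 insert by (auto simp: T'_def)
  have "rows_indep S T' (elim_row s0 t0 M)"
    using rows_indep_elim_row t0 insert unfolding T'_def by metis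
  moreover have "card T' \<le> card S" using insert T by simp
  ultimately have "rows_indep T' S (\<lambda>t s. elim_row s0 t0 M s t)"
    using insert.IH T(3) by blast
  also have "(\<lambda>t s. elim_row s0 t0 M s t) = elim_row t0 s0 (\<lambda>t s. M s t)"
    by (intro ext) (simp add: elim_row_def)
  also have "S = insert s0 S - {s0}" using insert by auto
  finally show ?case
    using rows_indep_elim_row[of "\<lambda>t s. M s t" t0 s0 T' "insert s0 S"] T t0 by simp
qed

text \<open>Extend the coefficients by zero outside the image of \<open>\<pi>\<close>.\<close>

lemma rows_indep_subset:
  assumes "rows_indep S' T M'" "finite S'" "inj_on \<pi> S" "\<pi> ` S \<subseteq> S'"
    and "\<And>s t. s \<in> S \<Longrightarrow> t \<in> T \<Longrightarrow> M s t = M' (\<pi> s) t"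
  shows "rows_indep S T M"
proof (rule rows_indepI)
  fix u s assume u: "\<And>t. t \<in> T \<Longrightarrow> (\<Sum>s\<in>S. u s * M s t) = 0" and s: "s \<in> S"
  define v where "v x = (if x \<in> \<pi> ` S then u (the_inv_into S \<pi> x) else 0)" for x
  have v: "v (\<pi> s) = u s" if "s \<in> S" for s
    using that assms(3) by (simp add: v_def the_inv_into_f_f)
  have "(\<Sum>x\<in>S'. v x * M' x t) = 0" if t: "t \<in> T" for t
  proof -
    have "(\<Sum>x\<in>S'. v x * M' x t) = (\<Sum>x\<in>\<pi> ` S. v x * M' x t)"
      by (rule sum.mono_neutral_right) (use assms in \<open>auto simp: v_def\<close>)
    also have "\<dots> = (\<Sum>s\<in>S. v (\<pi> s) * M' (\<pi> s) t)"
      by (simp add: sum.reindex[OF assms(3)])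
    also have "\<dots> = (\<Sum>s\<in>S. u s * M s t)"
      by (rule sum.cong) (use v assms(5) t in auto)
    finally show ?thesis using u[OF t] by simp
  qed
  from rows_indepD[where s = "\<pi> s", OF assms(1) this] s assms(4) v show "u s = 0" by auto
qed

section \<open>Polynomial functions\<close>

lemma poly_fun_uminus: "p \<in> poly_fun n \<Longrightarrow> (\<lambda>xs. - p xs) \<in> poly_fun n"
  using pf_mult[OF pf_const[of "-1" n], of p] by simp

lemma poly_fun_diff: "p \<in> poly_fun n \<Longrightarrow> q \<in> poly_fun n \<Longrightarrow> (\<lambda>xs. p xs - q xs) \<in> poly_fun n"
  using pf_add[OF _ poly_fun_uminus, of p n q] by simp

lemma poly_fun_sum: "(\<And>i. i \<in> A \<Longrightarrow> f i \<in> poly_fun n) \<Longrightarrow> (\<lambda>xs. \<Sum>i\<in>A. f i xs) \<in> poly_fun n"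
  by (induction A rule: infinite_finite_induct) (auto intro: pf_const pf_add)

lemma poly_fun_prod: "(\<And>i. i \<in> A \<Longrightarrow> f i \<in> poly_fun n) \<Longrightarrow> (\<lambda>xs. \<Prod>i\<in>A. f i xs) \<in> poly_fun n"
  by (induction A rule: infinite_finite_induct) (auto intro: pf_const pf_mult)

text \<open>The polynomial \<open>p\<close> is the product of the pivots met during elimination at
  \<open>x0\<close>; wherever none of them vanishes, the same pivots work.\<close>

lemma rows_indep_open:
  fixes M :: "'a::field list \<Rightarrow> 'r \<Rightarrow> 'c \<Rightarrow> 'a"
  assumes "finite S" "rows_indep S T (M x0)"
    and "\<And>s t. s \<in> S \<Longrightarrow> t \<in> T \<Longrightarrow> (\<lambda>xs. M xs s t) \<in> poly_fun n"
  shows "\<exists>p\<in>poly_fun n. p x0 \<noteq> 0 \<and> (\<forall>xs. p xs \<noteq> 0 \<longrightarrow> rows_indep S T (M xs))"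
  using assms
proof (induction S arbitrary: T M rule: finite_induct)
  case empty
  show ?case by (rule bexI[OF _ pf_const[of 1]]) (simp add: rows_indep_def)
next
  case (insert s0 S)
  obtain t0 where t0: "t0 \<in> T" "M x0 s0 t0 \<noteq> 0"
    using rows_indep_pivot insert by metis
  have "rows_indep S (T - {t0}) (elim_row s0 t0 (M x0))"
    using rows_indep_elim_row t0 insert by metis
  moreover have "(\<lambda>xs. elim_row s0 t0 (M xs) s t) \<in> poly_fun n" if "s \<in> S" "t \<in> T - {t0}" for s t
    unfolding elim_row_def using insert.prems(2) that t0 by (intro poly_fun_diff pf_mult) auto
  ultimately obtain p where p: "p \<in> poly_fun n" "p x0 \<noteq> 0"
    "\<And>xs. p xs \<noteq> 0 \<Longrightarrow> rows_indep S (T - {t0}) (elim_row s0 t0 (M xs))"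
    using insert.IH[of "T - {t0}" "\<lambda>xs. elim_row s0 t0 (M xs)"] by blast
  show ?case
  proof (rule bexI)
    show "(\<lambda>xs. M xs s0 t0 * p xs) \<in> poly_fun n"
      using insert.prems(2) t0 p by (intro pf_mult) auto
    show "M x0 s0 t0 * p x0 \<noteq> 0 \<and> (\<forall>xs. M xs s0 t0 * p xs \<noteq> 0 \<longrightarrow> rows_indep (insert s0 S) T (M xs))"
      using t0 p rows_indep_elim_row[of _ s0 t0 S T] insert.hyps by auto
  qed
qed

section \<open>Interpolation in one variable\<close>

text \<open>The hypothesis extends linearly from powers to every polynomial of degree less than
  \<open>card E\<close>; the choice \<open>Q\<close>, which vanishes at all nodes except
  \<open>\<nu> e0\<close>, isolates \<open>\<alpha> e0\<close>.\<close>

lemma vandermonde_indep: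
  fixes \<nu> :: "'i \<Rightarrow> 'a::field"
  assumes "finite E" "inj_on \<nu> E" "\<And>k. k < card E \<Longrightarrow> (\<Sum>e\<in>E. \<alpha> e * \<nu> e ^ k) = 0" "e0 \<in> E"
  shows "\<alpha> e0 = 0"
proof -
  define Q where "Q = (\<Prod>e\<in>E - {e0}. [:- \<nu> e, 1:])"
  have "degree Q = card (E - {e0})"
    unfolding Q_def by (subst degree_prod_eq_sum_degree) auto
  hence dQ: "degree Q < card E"
    using card_Diff1_less[OF assms(1,4)] by simp
  have "(\<Sum>e\<in>E. \<alpha> e * poly Q (\<nu> e)) = (\<Sum>e\<in>E. \<Sum>k\<le>degree Q. coeff Q k * (\<alpha> e * \<nu> e ^ k))"
    by (simp add: poly_altdef sum_distrib_left mult_ac)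
  also have "\<dots> = (\<Sum>k\<le>degree Q. \<Sum>e\<in>E. coeff Q k * (\<alpha> e * \<nu> e ^ k))"
    by (rule sum.swap)
  also have "\<dots> = (\<Sum>k\<le>degree Q. coeff Q k * (\<Sum>e\<in>E. \<alpha> e * \<nu> e ^ k))"
    by (simp add: sum_distrib_left)
  also have "\<dots> = 0"
    by (rule sum.neutral) (use assms(3) dQ in auto)
  finally have "(\<Sum>e\<in>E. \<alpha> e * poly Q (\<nu> e)) = 0" .
  moreover have "poly Q (\<nu> e) = 0" if "e \<in> E - {e0}" for e
    unfolding Q_def poly_prod using assms(1) that by (intro prod_zero bexI[of _ e]) auto
  hence "(\<Sum>e\<in>E. \<alpha> e * poly Q (\<nu> e)) = \<alpha> e0 * poly Q (\<nu> e0)"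
    using assms(1,4) by (subst sum.remove[of _ e0]) auto
  moreover have "poly Q (\<nu> e0) \<noteq> 0"
    unfolding Q_def poly_prod using assms by (auto simp: prod_zero_iff inj_on_def)
  ultimately show ?thesis by simp
qed

text \<open>Since \<open>(2 ^ k) ^ e = (2 ^ e) ^ k\<close>, the value condition at \<open>k\<close>
  is a k-th power moment whose weights are the coefficients of \<open>f\<close> and
  \<open>g\<close>. Nodes and moments are equal in number.\<close>

lemma eq_0_if_twisted_values_0:
  fixes f g :: "'a::field_char_0 poly"
  assumes deg: "\<And>e. e > m \<Longrightarrow> coeff f e = 0" "\<And>e. e \<ge> m \<Longrightarrow> coeff g e = 0"
    and z: "\<And>k. k < 2 * m + 1 \<Longrightarrow> poly f (2 ^ k) + 3 ^ k * poly g (2 ^ k) = 0"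
  shows "f = 0 \<and> g = 0"
proof -
  define E :: "(nat + nat) set" where "E = {..m} <+> {..<m}"
  \<comment> \<open>The nodes are natural numbers here: divisibility by 3 separates the two
    families, and characteristic zero transfers distinctness to the field.\<close>
  define \<nu> :: "nat + nat \<Rightarrow> nat" where "\<nu> = case_sum (\<lambda>e. 2 ^ e) (\<lambda>e. 3 * 2 ^ e)"
  define \<alpha> where "\<alpha> = case_sum (coeff f) (coeff g)"
  have fin: "finite E" and card: "card E = 2 * m + 1" by (auto simp: E_def card_Plus)
  have ne: "(2::nat) ^ e \<noteq> 3 * 2 ^ e'" for e e' :: nat
  proof
    assume "2 ^ e = 3 * (2::nat) ^ e'"
    hence "(3::nat) dvd 2 ^ e" by simp
    moreover have "\<not> (3::nat) dvd 2 ^ e" by (induction e) (auto, presburger)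
    ultimately show False by blast
  qed
  have "inj \<nu>"
    by (rule injI) (use ne ne[symmetric] in \<open>auto simp: \<nu>_def split: sum.splits\<close>)
  hence inj: "inj_on (\<lambda>e. of_nat (\<nu> e) :: 'a) E" by (auto simp: inj_on_def)
  have poly_cut: "poly h x = (\<Sum>e\<le>d. coeff h e * x ^ e)" if "\<And>e. e > d \<Longrightarrow> coeff h e = 0" for h :: "'a poly" and x d
    unfolding poly_altdef using degree_le[of d h] that
    by (intro sum.mono_neutral_left) (auto simp: coeff_eq_0)
  have "(\<Sum>e\<in>E. \<alpha> e * of_nat (\<nu> e) ^ k) = 0" if "k < card E" for k
  proof -
    have "poly g (2 ^ k) = (\<Sum>e<m. coeff g e * (2 ^ k) ^ e)"
      using poly_cut[of m g "2 ^ k"] deg(2) by (simp add: lessThan_Suc_atMost[symmetric])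
    hence g: "3 ^ k * poly g (2 ^ k) = (\<Sum>e<m. coeff g e * (3 * 2 ^ e) ^ k)"
      by (simp add: sum_distrib_left power_mult_distrib power_mult[symmetric] mult_ac)
    have "poly f (2 ^ k) = (\<Sum>e\<le>m. coeff f e * (2 ^ e) ^ k)"
      using poly_cut[of m f "2 ^ k"] deg(1) by (simp add: power_mult[symmetric] mult_ac)
    with g have "(\<Sum>e\<in>E. \<alpha> e * of_nat (\<nu> e) ^ k) = poly f (2 ^ k) + 3 ^ k * poly g (2 ^ k)"
      unfolding E_def by (subst sum.Plus) (simp_all add: \<alpha>_def \<nu>_def)
    with z that card show ?thesis by simp
  qed
  note v = vandermonde_indep[OF fin inj this]
  have "coeff f e = 0" for e
    using v[of "Inl e"] deg(1)[of e] by (cases "e \<le> m") (auto simp: E_def \<alpha>_def)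
  moreover have "coeff g e = 0" for e
    using v[of "Inr e"] deg(2)[of e] by (cases "e < m") (auto simp: E_def \<alpha>_def)
  ultimately show ?thesis by (simp add: poly_eq_iff)
qed

text \<open>Distinct linear factors are coprime: the product over the other nodes does not vanish at
  \<open>t k\<close>, so the whole multiplicity at \<open>t k\<close> lies in the cofactor
  \<open>h\<close>.\<close>

lemma prod_linear_powers_dvd:
  fixes f :: "'a::field poly"
  assumes "finite A" "inj_on t A" "\<And>k. k \<in> A \<Longrightarrow> [:- t k, 1:] ^ e k dvd f"
  shows "(\<Prod>k\<in>A. [:- t k, 1:] ^ e k) dvd f"
  using assms
proof (induction A rule: finite_induct)
  case (insert k A)
  then obtain h where h: "f = (\<Prod>k\<in>A. [:- t k, 1:] ^ e k) * h" by (auto elim!: dvdE)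
  define P where "P = (\<Prod>k\<in>A. [:- t k, 1:] ^ e k)"
  have P: "poly P (t k) \<noteq> 0"
    unfolding P_def poly_prod using insert by (auto simp: prod_zero_iff inj_on_def)
  have "[:- t k, 1:] ^ e k dvd h"
  proof (cases "h = 0")
    case False
    have f: "f = P * h" using h by (simp add: P_def)
    have "P \<noteq> 0" using P by auto
    with False have f0: "f \<noteq> 0" by (simp add: f)
    hence "order (t k) f = order (t k) h"
      using order_mult[of P h "t k"] order_0I[OF P] by (simp add: f)
    with False f0 insert.prems(2)[of k] show ?thesis by (simp add: order_divides)
  qed simp
  thus ?case using insert.hyps h by (simp add: mult.commute mult_dvd_mono)
qed simp

text \<open>Here \<open>b k\<close> is $b_i - 1$ in the notation above. For \<open>N \<le> j\<close>
  the cofactors \<open>f'\<close> and \<open>g'\<close> after division by \<open>P\<close> have at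
  most \<open>2 * (j - N) + 1\<close> coefficients together, and \<open>count\<close> yields at
  least as many value conditions.\<close>

lemma eq_0_if_twisted_powers_dvd:
  fixes f g :: "'a::field_char_0 poly"
  assumes deg: "\<And>e. e > j \<Longrightarrow> coeff f e = 0" "\<And>e. e \<ge> j \<Longrightarrow> coeff g e = 0"
    and dvd: "\<And>k. k < n \<Longrightarrow> [:- (2 ^ k), 1:] ^ Suc (b k) dvd f + smult (3 ^ k) g"
      "\<And>k. k < n \<Longrightarrow> [:- (2 ^ k), 1:] ^ b k dvd g"
    and count: "(\<Sum>k<n. 2 * b k + 1) \<ge> 2 * j + 1"
  shows "f = 0 \<and> g = 0"
proof -
  define N where "N = (\<Sum>k<n. b k)"
  define P :: "'a poly" where "P = (\<Prod>k<n. [:- (2 ^ k), 1:] ^ b k)"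
  have cnt: "2 * N + n \<ge> 2 * j + 1"
    using count by (simp add: N_def sum.distrib sum_distrib_left sum_Suc)
  have inj: "inj_on (\<lambda>k. 2 ^ k :: 'a) A" for A :: "nat set"
  proof (rule inj_onI)
    fix x y :: nat assume "(2 ^ x :: 'a) = 2 ^ y"
    hence "(of_nat (2 ^ x) :: 'a) = of_nat (2 ^ y)" by simp
    thus "x = y" by (simp only: of_nat_eq_iff) simp
  qed
  have "P dvd g" unfolding P_def using dvd(2) inj by (intro prod_linear_powers_dvd) auto
  then obtain g' where g': "g = P * g'" by (elim dvdE)
  have "P dvd f" unfolding P_def
  proof (intro prod_linear_powers_dvd)
    fix k assume "k \<in> {..<n}"
    hence k: "k < n" by simp
    have "[:- (2 ^ k), 1:] ^ b k dvd f + smult (3 ^ k) g"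
      using dvd(1)[OF k] by (meson dvd_trans le_imp_power_dvd lessI less_imp_le)
    moreover have "[:- (2 ^ k), 1:] ^ b k dvd smult (3 ^ k) g"
      using dvd(2)[OF k] by (rule dvd_smult)
    ultimately show "[:- (2 ^ k), 1:] ^ b k dvd f" by (simp add: dvd_add_left_iff)
  qed (use inj in auto)
  then obtain f' where f': "f = P * f'" by (elim dvdE)
  have P0: "P \<noteq> 0" by (auto simp: P_def prod_zero_iff)
  have dP: "degree P = N"
    unfolding P_def N_def by (subst degree_prod_eq_sum_degree) (auto simp: degree_power_eq)
  \<comment> \<open>The bound is stated per nonzero coefficient so that it also covers
    \<open>N > j\<close>, where truncated subtraction would lose it.\<close>
  have df: "N + e \<le> j" if "coeff f' e \<noteq> 0" for e
  proof -
    have "f' \<noteq> 0" using that by auto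
    hence "degree f = N + degree f'" "f \<noteq> 0" using P0 dP by (auto simp: f' degree_mult_eq)
    moreover have "degree f \<le> j" using deg(1) by (intro degree_le) auto
    moreover have "e \<le> degree f'" using that by (rule le_degree)
    ultimately show ?thesis by simp
  qed
  have dg: "N + e < j" if "coeff g' e \<noteq> 0" for e
  proof -
    have "g' \<noteq> 0" using that by auto
    hence *: "degree g = N + degree g'" "g \<noteq> 0" using P0 dP by (auto simp: g' degree_mult_eq)
    have "degree g < j"
    proof (rule ccontr)
      assume "\<not> degree g < j"
      hence "lead_coeff g = 0" using deg(2)[of "degree g"] by simp
      with *(2) show False by (simp only: leading_coeff_0_iff)
    qed
    moreover have "e \<le> degree g'" using that by (rule le_degree)
    ultimately show ?thesis using * by simp
  qed
  \<comment> \<open>Cancelling \<open>b k\<close> of the \<open>b k + 1\<close> linear factors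
    leaves one, and \<open>Q\<close> does not vanish at the node.\<close>
  have root: "poly f' (2 ^ k) + 3 ^ k * poly g' (2 ^ k) = 0" if k: "k < n" for k
  proof -
    define Q :: "'a poly" where "Q = (\<Prod>k\<in>{..<n} - {k}. [:- (2 ^ k), 1:] ^ b k)"
    have P: "P = [:- (2 ^ k), 1:] ^ b k * Q"
      unfolding P_def Q_def using k by (intro prod.remove) auto
    have Q: "poly Q (2 ^ k) \<noteq> 0"
      unfolding Q_def poly_prod using inj[of UNIV] by (auto simp: prod_zero_iff inj_on_def)
    have "[:- (2 ^ k), 1:] ^ Suc (b k) dvd [:- (2 ^ k), 1:] ^ b k * (Q * (f' + smult (3 ^ k) g'))"
      using dvd(1)[OF k] by (simp add: f' g' P algebra_simps)
    hence "[:- (2 ^ k), 1:] dvd Q * (f' + smult (3 ^ k) g')"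
      by (simp only: power_Suc2 dvd_mult_cancel_left) simp
    thus ?thesis using Q by (simp add: dvd_iff_poly_eq_0)
  qed
  have "f' = 0 \<and> g' = 0"
  proof (cases "N \<le> j")
    case True
    show ?thesis
    proof (rule eq_0_if_twisted_values_0[of "j - N"])
      show "coeff f' e = 0" if "e > j - N" for e using df[of e] that by force
      show "coeff g' e = 0" if "e \<ge> j - N" for e using dg[of e] that by force
      show "poly f' (2 ^ k) + 3 ^ k * poly g' (2 ^ k) = 0" if "k < 2 * (j - N) + 1" for k
        using root[of k] that cnt True by simp
    qed
  next
    case False
    \<comment> \<open>With \<open>N > j\<close> no exponent satisfies the bounds, so all
      coefficients vanish.\<close>
    thus ?thesis using df dg by (force simp: poly_eq_iff)
  qed
  thus ?thesis by (simp add: f' g')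
qed

section \<open>Coefficients and homogeneous components\<close>

definition mons :: "nat \<Rightarrow> (nat \<times> nat \<times> nat) set" where
  "mons d = {(i, j, k). i + j + k = d}"

definition mon :: "nat \<times> nat \<times> nat \<Rightarrow> 'a::comm_ring_1 mpoly3" where
  "mon = (\<lambda>(i, j, k). monom (monom (monom 1 i) j) k)"

definition cf :: "nat \<times> nat \<times> nat \<Rightarrow> 'a::zero mpoly3 \<Rightarrow> 'a" where
  "cf = (\<lambda>(i, j, k) p. coeff3 p i j k)"

lemma finite_mons [simp]: "finite (mons d)"
  by (rule finite_subset[of _ "{..d} \<times> {..d} \<times> {..d}"]) (auto simp: mons_def)

lemma mons_iff [simp]: "(i, j, k) \<in> mons d \<longleftrightarrow> i + j + k = d"
  by (simp add: mons_def)

lemma cf_eqI: "(\<And>m. cf m p = cf m q) \<Longrightarrow> p = q"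
  by (force simp: cf_def coeff3_def poly_eq_iff)

lemma cf_0 [simp]: "cf m 0 = 0"
  by (cases m) (simp add: cf_def coeff3_def)

lemma cf_add [simp]: "cf m (p + q) = cf m p + cf m q"
  by (cases m) (simp add: cf_def coeff3_def)

lemma cf_sum: "cf m (\<Sum>x\<in>A. p x) = (\<Sum>x\<in>A. cf m (p x))"
  by (induction A rule: infinite_finite_induct) auto

lemma cf_const_mult [simp]: "cf m (const3 c * p) = c * cf m p"
  by (cases m) (simp add: cf_def coeff3_def const3_def)

lemma cf_mon: "cf m (mon m') = (if m = m' then 1 else 0)"
  by (cases m; cases m') (auto simp: cf_def coeff3_def mon_def)

lemma cf_mult:
  "cf (i, j, k) (p * q) = (\<Sum>k'\<le>k. \<Sum>j'\<le>j. \<Sum>i'\<le>i. cf (i', j', k') p * cf (i - i', j - j', k - k') q)"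
  by (simp add: cf_def coeff3_def coeff_mult coeff_sum)

lemma const3_simps [simp]:
  fixes a b :: "'a::comm_ring_1"
  shows "const3 0 = (0 :: 'a mpoly3)" "const3 1 = (1 :: 'a mpoly3)"
    "const3 (a * b) = const3 a * const3 b" "const3 (a + b) = const3 a + const3 b"
  by (simp_all add: const3_def one_pCons)

lemma const3_power: "const3 (a ^ n) = const3 a ^ n" for a :: "'a::comm_ring_1"
  by (induction n) auto

lemma const3_of_nat: "const3 (of_nat n :: 'a::comm_ring_1) = of_nat n"
  by (induction n) auto

lemma mon_mult: "mon (i, j, k) * mon (i', j', k') = mon (i + i', j + j', k + k')"
  by (simp add: mon_def mult_monom)

lemma mon_0: "mon (0, 0, 0) = 1"
  by (simp add: mon_def)

lemma mon_power: "mon (i, j, k) ^ n = mon (i * n, j * n, k * n)"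
  by (simp add: mon_def monom_power)

lemma linform_mon: "linform u v w = const3 u * mon (1, 0, 0) + const3 v * mon (0, 1, 0) + const3 w * mon (0, 0, 1)"
  by (simp add: linform_def varX_def varY_def varZ_def mon_def monom_altdef one_pCons)

lemma cf_mon_z_mult: "k < k' \<Longrightarrow> cf (i, j, k) (mon (0, 0, k') * p) = 0"
  by (simp add: cf_def coeff3_def mon_def coeff_monom_mult)

lemma hom_part_iff: "p \<in> hom_part (int d) \<longleftrightarrow> (\<forall>m. cf m p \<noteq> 0 \<longrightarrow> m \<in> mons d)"
  by (auto simp: hom_part_def cf_def simp flip: of_nat_add)

lemma hom_part_add: "p \<in> hom_part d \<Longrightarrow> q \<in> hom_part d \<Longrightarrow> p + q \<in> hom_part d"
  by (auto simp: hom_part_def coeff3_def) (metis add.right_neutral)+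

lemma hom_part_const_mult: "p \<in> hom_part d \<Longrightarrow> const3 c * p \<in> hom_part d"
  for p :: "'a::comm_ring_1 mpoly3"
  by (auto simp: hom_part_def coeff3_def const3_def) (metis mult_zero_right)+

lemma hom_part_sum: "(\<And>x. x \<in> A \<Longrightarrow> p x \<in> hom_part d) \<Longrightarrow> sum p A \<in> hom_part d"
proof (induction A rule: infinite_finite_induct)
  case (insert x A)
  thus ?case by (simp add: hom_part_add)
qed (simp_all add: hom_part_def coeff3_def)

lemma hom_part_mon: "m \<in> mons d \<Longrightarrow> mon m \<in> hom_part (int d)"
  by (auto simp: hom_part_iff cf_mon split: if_splits)

lemma hom_part_linform: "linform u v w \<in> hom_part (int 1)"
  unfolding linform_mon by (intro hom_part_add hom_part_const_mult hom_part_mon) auto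

definition hom_comp :: "nat \<Rightarrow> 'a::comm_ring_1 mpoly3 \<Rightarrow> 'a mpoly3" where
  "hom_comp d p = (\<Sum>m\<in>mons d. const3 (cf m p) * mon m)"

lemma cf_hom_comp: "cf m (hom_comp d p) = (if m \<in> mons d then cf m p else 0)"
  by (simp add: hom_comp_def cf_sum cf_mon if_distrib[of "\<lambda>x. _ * x"] cong: if_cong)

lemma hom_comp_hom_part: "hom_comp d p \<in> hom_part (int d)"
  by (simp add: hom_part_iff cf_hom_comp)

lemma hom_comp_id: "p \<in> hom_part (int d) \<Longrightarrow> hom_comp d p = p"
  by (rule cf_eqI) (metis cf_hom_comp hom_part_iff)

lemma hom_comp_add: "hom_comp d (p + q) = hom_comp d p + hom_comp d q"
  by (rule cf_eqI) (auto simp: cf_hom_comp)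

lemma hom_comp_sum: "hom_comp d (\<Sum>x\<in>A. p x) = (\<Sum>x\<in>A. hom_comp d (p x))"
  by (rule cf_eqI) (auto simp: cf_hom_comp cf_sum)

text \<open>Only monomials of degree \<open>e\<close> occur in \<open>F\<close>, so multiplication
  shifts every degree by exactly \<open>e\<close>. This serves to replace arbitrary ideal
  multipliers by homogeneous ones.\<close>

lemma hom_comp_mult:
  assumes "F \<in> hom_part (int e)"
  shows "hom_comp d (F * p) = (if e \<le> d then F * hom_comp (d - e) p else 0)"
proof (rule cf_eqI)
  fix m :: "nat \<times> nat \<times> nat"
  obtain i j k where m: "m = (i, j, k)" by (cases m)
  have F: "i' + j' + k' = e" if "cf (i', j', k') F \<noteq> 0" for i' j' k'
    using assms that by (auto simp: hom_part_iff)
  show "cf m (hom_comp d (F * p)) = cf m (if e \<le> d then F * hom_comp (d - e) p else 0)"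
  proof (cases "e \<le> d")
    case True
    have "cf (i', j', k') F * cf (i - i', j - j', k - k') (hom_comp (d - e) p) =
        (if i + j + k = d then cf (i', j', k') F * cf (i - i', j - j', k - k') p else 0)"
      if "i' \<le> i" "j' \<le> j" "k' \<le> k" for i' j' k'
      using F[of i' j' k'] that True by (cases "cf (i', j', k') F = 0") (auto simp: cf_hom_comp)
    thus ?thesis using True by (simp add: m cf_hom_comp cf_mult)
  next
    case False
    have "cf (i', j', k') F * cf (i - i', j - j', k - k') p = 0"
      if "i' \<le> i" "j' \<le> j" "k' \<le> k" "i + j + k = d" for i' j' k'
      using F[of i' j' k'] that False by (cases "cf (i', j', k') F = 0") auto
    thus ?thesis using False by (simp add: m cf_hom_comp cf_mult)
  qed
qed

lemma hom_part_mult: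
  fixes p q :: "'a::comm_ring_1 mpoly3"
  assumes "p \<in> hom_part (int d)" "q \<in> hom_part (int e)"
  shows "p * q \<in> hom_part (int (d + e))"
proof -
  have "hom_comp (e + d) (p * q) = p * hom_comp e q" using hom_comp_mult[OF assms(1), of "e + d" q] by simp
  thus ?thesis using hom_comp_id[OF assms(2)] hom_comp_hom_part[of "e + d" "p * q"] by (simp add: add.commute)
qed

lemma hom_part_power:
  fixes p :: "'a::comm_ring_1 mpoly3"
  assumes "p \<in> hom_part (int 1)" 
  shows "p ^ n \<in> hom_part (int n)"
proof (induction n)
  case 0
  show ?case using hom_part_mon[of "(0,0,0)" 0, where 'a = 'a] by (simp add: mon_0)
next
  case (Suc n)
  show ?case using hom_part_mult[OF assms Suc] by simp
qed

section \<open>The special point\<close>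

text \<open>The linear functional on $R_j$ with value \<open>U m\<close> on the monomial
  \<open>m\<close>, extended by zero to the other degrees.\<close>

definition pairing :: "nat \<Rightarrow> (nat \<times> nat \<times> nat \<Rightarrow> 'a) \<Rightarrow> 'a::comm_ring_1 mpoly3 \<Rightarrow> 'a" where
  "pairing j U p = (\<Sum>m\<in>mons j. U m * cf m p)"

lemma pairing_add: "pairing j U (p + q) = pairing j U p + pairing j U q"
  by (simp add: pairing_def algebra_simps sum.distrib)

lemma pairing_const_mult: "pairing j U (const3 c * p) = c * pairing j U p"
  unfolding pairing_def sum_distrib_left by (rule sum.cong) simp_all

lemma pairing_sum: "pairing j U (\<Sum>x\<in>A. p x) = (\<Sum>x\<in>A. pairing j U (p x))"
  unfolding pairing_def cf_sum sum_distrib_left by (rule sum.swap)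

lemma pairing_mon: "m \<in> mons j \<Longrightarrow> pairing j U (mon m) = U m"
  by (simp add: pairing_def cf_mon if_distrib[of "\<lambda>x. _ * x"] cong: if_cong)

lemma pairing_hom_comp: "pairing j U (hom_comp j p) = pairing j U p"
  by (simp add: pairing_def cf_hom_comp)

text \<open>Binomial expansion at \<open>T = t\<close>, from $x + Ty + cz = (T - t)y + (x + ty +
  cz)$.\<close>

lemma linform_shift_power:
  "linform 1 T c ^ n = (\<Sum>q\<le>n. const3 (of_nat (n choose q) * (T - t) ^ q) * (mon (0, q, 0) * linform 1 t c ^ (n - q)))"
proof -
  have "const3 T = const3 (T - t) + const3 t" by (simp flip: const3_simps)
  hence "linform 1 T c = const3 (T - t) * mon (0, 1, 0) + linform 1 t c"
    by (simp add: linform_mon algebra_simps)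
  thus ?thesis
    by (simp add: binomial_ring power_mult_distrib mon_power const3_power const3_of_nat mult_ac)
qed

text \<open>Binomial expansion modulo $z^2$; for \<open>n = 0\<close> the truncated exponent
  \<open>n - 1\<close> is harmless because its coefficient is zero.\<close>

lemma linform_z_power:
  fixes c T :: "'a::comm_ring_1"
  shows "\<exists>R. linform 1 T c ^ n = linform 1 T 0 ^ n + const3 (of_nat n * c) * (mon (0, 0, 1) * linform 1 T 0 ^ (n - 1)) + mon (0, 0, 2) * R"
proof -
  have e: "linform 1 T c = linform 1 T 0 + const3 c * mon (0, 0, 1)"
    by (simp add: linform_mon)
  show ?thesis
  proof (induction n)
    case (Suc n)
    then obtain R where R: "linform 1 T c ^ n = linform 1 T 0 ^ n + const3 (of_nat n * c) * (mon (0, 0, 1) * linform 1 T 0 ^ (n - 1)) + mon (0, 0, 2) * R" by blast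
    have z: "mon (0, 0, 1) * mon (0, 0, 1) = mon (0, 0, 2)" by (simp add: mon_mult numeral_2_eq_2)
    show ?case
    proof (intro exI)
      show "linform 1 T c ^ Suc n = linform 1 T 0 ^ Suc n + const3 (of_nat (Suc n) * c) * (mon (0, 0, 1) * linform 1 T 0 ^ (Suc n - 1))
        + mon (0, 0, 2) * (linform 1 T c * R + const3 (of_nat n * c) * const3 c * linform 1 T 0 ^ (n - 1))"
        unfolding power_Suc R
        using const3_of_nat[of 2, where 'a = 'a]
        by (cases n) (simp_all add: e z[symmetric] algebra_simps)
    qed
  qed (auto intro: exI[of _ 0])
qed

text \<open>Over an infinite field the values determine \<open>F\<close>, and its expansion in
  powers of \<open>T - t\<close> has no term of exponent below \<open>b\<close>.\<close>

lemma linear_power_dvd: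
  fixes F :: "'a::field_char_0 poly"
  assumes "\<And>T. poly F T = (\<Sum>q\<le>n. w q * (T - t) ^ q)" "\<And>q. q < b \<Longrightarrow> q \<le> n \<Longrightarrow> w q = 0"
  shows "[:- t, 1:] ^ b dvd F"
proof -
  have "poly F = poly (\<Sum>q\<le>n. smult (w q) ([:- t, 1:] ^ q))"
    using assms(1) by (intro ext) (simp add: poly_sum)
  hence F: "F = (\<Sum>q\<le>n. smult (w q) ([:- t, 1:] ^ q))" by (simp only: poly_eq_poly_eq_iff)
  show ?thesis unfolding F
  proof (rule dvd_sum)
    fix q assume "q \<in> {..n}"
    thus "[:- t, 1:] ^ b dvd smult (w q) ([:- t, 1:] ^ q)"
      using assms(2)[of q] by (cases "q < b") (auto intro!: dvd_smult le_imp_power_dvd)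
  qed
qed

text \<open>Up to nonzero scalars, the values of \<open>U\<close> on monomials of z-exponent 0 and 1
  are the coefficients of \<open>f\<close> and \<open>g\<close>, which the interpolation lemma
  forces to vanish; the other values vanish by \<open>B\<close>.\<close>

lemma special_pairing_eq_0:
  fixes U :: "nat \<times> nat \<times> nat \<Rightarrow> 'a::field_char_0"
  assumes j: "2 \<le> j" and aj: "\<And>k. k < n \<Longrightarrow> a k \<le> j"
    and count: "(\<Sum>k<n. 2 * (j - a k) + 1) \<ge> 2 * j + 1"
    and A: "\<And>k m. k < n \<Longrightarrow> m \<in> mons (j - a k) \<Longrightarrow> snd (snd m) \<le> 1 \<Longrightarrow>
      pairing j U (mon m * linform 1 (2 ^ k) (3 ^ k) ^ a k) = 0"
    and B: "\<And>m. m \<in> mons (j - 2) \<Longrightarrow> pairing j U (mon m * linform 0 0 1 ^ 2) = 0"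
    and m: "m \<in> mons j"
  shows "U m = 0"
proof -
  have Z: "linform 0 0 1 ^ 2 = (mon (0, 0, 2) :: 'a mpoly3)"
    by (simp add: linform_mon mon_power)
  have U2: "U (x, y, z) = 0" if "z \<ge> 2" "x + y + z = j" for x y z
  proof -
    have "mon (x, y, z) = mon (x, y, z - 2) * (mon (0, 0, 2) :: 'a mpoly3)"
      using that(1) by (simp only: mon_mult add_0_right le_add_diff_inverse2)
    moreover have "pairing j U (mon (x, y, z)) = U (x, y, z)" using that by (simp add: pairing_mon)
    ultimately show ?thesis using B[of "(x, y, z - 2)"] Z that by simp
  qed
  have pz: "pairing j U (mon (0, 0, 2) * p) = 0" for p
  proof -
    have "U m * cf m (mon (0, 0, 2) * p) = 0" if "m \<in> mons j" for m
      using U2 cf_mon_z_mult[of _ 2 _ _ p] that by (cases m) (metis leI mons_iff mult_eq_0_iff)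
    thus ?thesis unfolding pairing_def by (intro sum.neutral ballI)
  qed
  \<comment> \<open>\<open>A\<close> tests only representatives modulo $z^2$. The fact
    \<open>pz\<close> supplies the other monomials, linearity all multipliers of degree
    \<open>j - a k\<close>, and components of other degrees pair to zero.\<close>
  have kill: "pairing j U (p * linform 1 (2 ^ k) (3 ^ k) ^ b) = 0" if k: "k < n" and b: "b \<ge> a k" for k p b
  proof -
    define L :: "'a mpoly3" where "L = linform 1 (2 ^ k) (3 ^ k) ^ a k"
    have L: "L \<in> hom_part (int (a k))"
      unfolding L_def by (intro hom_part_power hom_part_linform)
    have mon: "pairing j U (mon m * L) = 0" if m: "m \<in> mons (j - a k)" for m
    proof (cases "snd (snd m) \<le> 1")
      case True
      thus ?thesis unfolding L_def using A[OF k m] by blast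
    next
      case False
      obtain x y z where [simp]: "m = (x, y, z)" by (cases m)
      have "mon m = mon (0, 0, 2) * (mon (x, y, z - 2) :: 'a mpoly3)"
      proof -
        have "2 + (z - 2) = z" using False by simp
        thus ?thesis by (simp only: mon_mult add_0 \<open>m = (x, y, z)\<close>)
      qed
      thus ?thesis using pz[of "mon (x, y, z - 2) * L"] by (simp add: mult.assoc)
    qed
    have *: "pairing j U (L * q) = 0" for q
    proof -
      have "hom_comp j (L * q) = (\<Sum>m\<in>mons (j - a k). const3 (cf m q) * (mon m * L))"
        using aj[OF k] by (subst hom_comp_mult[OF L]) (simp add: hom_comp_def[of _ q] sum_distrib_left mult_ac)
      hence "pairing j U (hom_comp j (L * q)) = 0"
        by (simp add: pairing_sum pairing_const_mult mon)
      thus ?thesis by (simp add: pairing_hom_comp)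
    qed
    have "p * linform 1 (2 ^ k) (3 ^ k) ^ b = L * (p * linform 1 (2 ^ k) (3 ^ k) ^ (b - a k))"
      using b by (simp add: L_def mult_ac flip: power_add)
    thus ?thesis by (simp only: *)
  qed
  define f where "f = (\<Sum>k\<le>j. monom (of_nat (j choose k) * U (j - k, k, 0)) k)"
  define g where "g = (\<Sum>k\<le>j-1. monom (of_nat j * (of_nat ((j - 1) choose k) * U (j - 1 - k, k, 1))) k)"
  have cff: "coeff f k = (if k \<le> j then of_nat (j choose k) * U (j - k, k, 0) else 0)" for k
    by (simp add: f_def coeff_sum)
  have cfg: "coeff g k = (if k \<le> j - 1 then of_nat j * (of_nat ((j - 1) choose k) * U (j - 1 - k, k, 1)) else 0)" for k
    by (simp add: g_def coeff_sum)
  have pw: "linform 1 T 0 ^ n = (\<Sum>k\<le>n. const3 (of_nat (n choose k) * T ^ k) * mon (n - k, k, 0))" for T :: 'a and n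
    using linform_shift_power[of T 0 n 0] by (simp add: linform_mon mon_power mon_mult)
  have pf: "pairing j U (linform 1 T 0 ^ j) = poly f T" for T
    unfolding pw pairing_sum pairing_const_mult f_def poly_sum
    by (rule sum.cong) (simp_all add: pairing_mon poly_monom)
  have pg: "of_nat j * pairing j U (mon (0, 0, 1) * linform 1 T 0 ^ (j - 1)) = poly g T" for T
  proof -
    have "mon (0, 0, 1) * linform 1 T 0 ^ (j - 1) = (\<Sum>k\<le>j-1. const3 (of_nat ((j - 1) choose k) * T ^ k) * mon (j - 1 - k, k, 1))"
      unfolding pw sum_distrib_left by (rule sum.cong) (simp_all add: mult_ac mon_mult mult.left_commute[of "mon _"])
    hence "of_nat j * pairing j U (mon (0, 0, 1) * linform 1 T 0 ^ (j - 1)) =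
       (\<Sum>k\<le>j-1. of_nat j * ((of_nat ((j - 1) choose k) * T ^ k) * pairing j U (mon (j - 1 - k, k, 1))))"
      by (simp only: pairing_sum pairing_const_mult sum_distrib_left)
    also have "\<dots> = poly g T"
      unfolding g_def poly_sum
      by (rule sum.cong) (use j in \<open>simp_all add: pairing_mon poly_monom\<close>)
    finally show ?thesis .
  qed
  have pfg: "pairing j U (linform 1 T c ^ j) = poly (f + smult c g) T" for T c
  proof -
    obtain R where "linform 1 T c ^ j = linform 1 T 0 ^ j + const3 (of_nat j * c) * (mon (0, 0, 1) * linform 1 T 0 ^ (j - 1)) + mon (0, 0, 2) * R"
      using linform_z_power by blast
    hence "pairing j U (linform 1 T c ^ j) = poly f T + of_nat j * c * pairing j U (mon (0, 0, 1) * linform 1 T 0 ^ (j - 1))"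
      by (simp only: pairing_add pairing_const_mult pz pf add_0_right)
    thus ?thesis by (simp add: mult_ac flip: pg)
  qed
  \<comment> \<open>After multiplication by z the coefficient \<open>c\<close> no longer matters
    modulo $z^2$, so \<open>g\<close> can be expanded about the form with
    \<open>c = 3 ^ k\<close>.\<close>
  have pg': "of_nat j * pairing j U (mon (0, 0, 1) * linform 1 T c ^ (j - 1)) = poly g T" for T c
  proof -
    obtain R where R: "linform 1 T c ^ (j - 1) = linform 1 T 0 ^ (j - 1) + const3 (of_nat (j - 1) * c) * (mon (0, 0, 1) * linform 1 T 0 ^ (j - 1 - 1)) + mon (0, 0, 2) * R"
      using linform_z_power by blast
    have z: "mon (0, 0, 2) = mon (0, 0, 1) * (mon (0, 0, 1) :: 'a mpoly3)" by (simp add: mon_mult numeral_2_eq_2)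
    have "mon (0, 0, 1) * linform 1 T c ^ (j - 1) = mon (0, 0, 1) * linform 1 T 0 ^ (j - 1)
       + mon (0, 0, 2) * (const3 (of_nat (j - 1) * c) * linform 1 T 0 ^ (j - 1 - 1) + mon (0, 0, 1) * R)"
      unfolding R z by (simp add: algebra_simps)
    thus ?thesis by (simp only: pairing_add pz pg add_0_right)
  qed
  have "f = 0 \<and> g = 0"
  proof (rule eq_0_if_twisted_powers_dvd)
    show "coeff f e = 0" if "e > j" for e using that by (simp add: cff)
    show "coeff g e = 0" if "e \<ge> j" for e using that j by (simp add: cfg)
    show "(\<Sum>k<n. 2 * (j - a k) + 1) \<ge> 2 * j + 1" by (fact count)
    fix k assume k: "k < n"
    let ?L = "linform 1 (2 ^ k) (3 ^ k) :: 'a mpoly3"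
    \<comment> \<open>The q-th coefficient pairs with a multiple of \<open>?L ^ (j - q)\<close>,
      which is killed as long as \<open>q \<le> j - a k\<close>.\<close>
    show "[:- (2 ^ k), 1:] ^ Suc (j - a k) dvd f + smult (3 ^ k) g"
    proof (rule linear_power_dvd)
      show "poly (f + smult (3 ^ k) g) T = (\<Sum>q\<le>j. (of_nat (j choose q) * pairing j U (mon (0, q, 0) * ?L ^ (j - q))) * (T - 2 ^ k) ^ q)" for T
        unfolding pfg[symmetric] linform_shift_power[of T _ _ "2 ^ k"] pairing_sum pairing_const_mult by (simp add: mult_ac)
      show "of_nat (j choose q) * pairing j U (mon (0, q, 0) * ?L ^ (j - q)) = 0" if "q < Suc (j - a k)" for q
        using kill[OF k, of "j - q"] aj[OF k] that by simp
    qed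
    \<comment> \<open>Here the form has exponent \<open>j - 1\<close>, so one order of vanishing is
      lost.\<close>
    show "[:- (2 ^ k), 1:] ^ (j - a k) dvd g"
    proof (rule linear_power_dvd)
      show "poly g T = (\<Sum>q\<le>j-1. (of_nat j * (of_nat ((j - 1) choose q) * pairing j U (mon (0, 0, 1) * (mon (0, q, 0) * ?L ^ (j - 1 - q))))) * (T - 2 ^ k) ^ q)" for T
      proof -
        have "mon (0, 0, 1) * linform 1 T (3 ^ k) ^ (j - 1) = (\<Sum>q\<le>j-1. const3 (of_nat ((j - 1) choose q) * (T - 2 ^ k) ^ q) * (mon (0, 0, 1) * (mon (0, q, 0) * ?L ^ (j - 1 - q))))"
          unfolding linform_shift_power[of T _ _ "2 ^ k"] sum_distrib_left by (simp only: mult.left_commute)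
        hence "pairing j U (mon (0, 0, 1) * linform 1 T (3 ^ k) ^ (j - 1)) = (\<Sum>q\<le>j-1. of_nat ((j - 1) choose q) * (T - 2 ^ k) ^ q * pairing j U (mon (0, 0, 1) * (mon (0, q, 0) * ?L ^ (j - 1 - q))))"
          by (simp only: pairing_sum pairing_const_mult)
        thus ?thesis
          unfolding pg'[of T "3 ^ k", symmetric] by (simp add: sum_distrib_left mult_ac)
      qed
      show "of_nat j * (of_nat ((j - 1) choose q) * pairing j U (mon (0, 0, 1) * (mon (0, q, 0) * ?L ^ (j - 1 - q)))) = 0" if "q < j - a k" for q
        using kill[OF k, of "j - 1 - q" "mon (0, 0, 1) * mon (0, q, 0)"] aj[OF k] that by (simp add: mult.assoc)
    qed
  qed
  \<comment> \<open>The binomial coefficients and \<open>j\<close> are nonzero in characteristic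
    zero, so vanishing coefficients give vanishing values of \<open>U\<close>.\<close>
  hence f: "\<And>k. coeff f k = 0" and g: "\<And>k. coeff g k = 0" by auto
  obtain x y z where [simp]: "m = (x, y, z)" by (cases m)
  have xyz: "x + y + z = j" using m by simp
  consider "z = 0" | "z = 1" | "z \<ge> 2" by linarith
  thus ?thesis
  proof cases
    case 1
    have "j - y = x" "y \<le> j" using 1 xyz by auto
    thus ?thesis using f[of y] 1 by (simp add: cff)
  next
    case 2
    have "j - 1 - y = x" "y \<le> j - 1" using 2 xyz by auto
    thus ?thesis using g[of y] 2 j by (simp add: cfg)
  next
    case 3
    thus ?thesis using U2 xyz by simp
  qed
qed

section \<open>The multiplication matrix\<close>

text \<open>Columns are the products of a monomial with a generator; the index \<open>s\<close> stands for $L^2$. Monomials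
with $z$-exponent at most 1 represent $R/L^2$, which removes the trivial syzygies between $L_i^{a_i}$
and $L^2$.\<close>

definition colset :: "nat \<Rightarrow> (nat \<Rightarrow> nat) \<Rightarrow> nat \<Rightarrow> nat \<Rightarrow> (nat \<times> nat \<times> nat) set" where
  "colset s a j i =
     (if i < s then if a i \<le> j then {m \<in> mons (j - a i). snd (snd m) \<le> 1} else {} else mons (j - 2))"

definition cols :: "nat \<Rightarrow> (nat \<Rightarrow> nat) \<Rightarrow> nat \<Rightarrow> (nat \<times> nat \<times> nat \<times> nat) set" where
  "cols s a j = Sigma {..s} (colset s a j)"

definition matr :: "(nat \<Rightarrow> 'a::comm_ring_1 mpoly3) \<Rightarrow> nat \<times> nat \<times> nat \<Rightarrow> nat \<times> nat \<times> nat \<times> nat \<Rightarrow> 'a" where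
  "matr G r t = cf r (mon (snd t) * G (fst t))"

lemma finite_colset [simp]: "finite (colset s a j i)"
  by (simp add: colset_def)

lemma finite_cols [simp]: "finite (cols s a j)"
  by (simp add: cols_def)

text \<open>Block \<open>i\<close> of \<open>v\<close> lists the coefficients of a multiplier of
  \<open>G i\<close>, so column combinations are elements of the ideal plus a multiple of
  \<open>G s\<close>.\<close>

lemma sum_cols:
  "(\<Sum>t\<in>cols s a j. const3 (v t) * (mon (snd t) * G (fst t))) =
     (\<Sum>i<s. (\<Sum>m\<in>colset s a j i. const3 (v (i, m)) * mon m) * G i)
       + (\<Sum>m\<in>mons (j - 2). const3 (v (s, m)) * mon m) * G s"
proof -
  have "(\<Sum>t\<in>cols s a j. const3 (v t) * (mon (snd t) * G (fst t))) =
    (\<Sum>i\<le>s. \<Sum>m\<in>colset s a j i. const3 (v (i, m)) * (mon m * G i))"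
    unfolding cols_def by (subst sum.Sigma) (auto simp: case_prod_unfold)
  also have "\<dots> = (\<Sum>i\<le>s. (\<Sum>m\<in>colset s a j i. const3 (v (i, m)) * mon m) * G i)"
    by (simp add: sum_distrib_right mult.assoc)
  also have "\<dots> = (\<Sum>i<s. (\<Sum>m\<in>colset s a j i. const3 (v (i, m)) * mon m) * G i)
       + (\<Sum>m\<in>colset s a j s. const3 (v (s, m)) * mon m) * G s"
    unfolding lessThan_Suc_atMost[symmetric] by (simp add: add.commute)
  also have "colset s a j s = mons (j - 2)" by (simp add: colset_def)
  finally show ?thesis .
qed

section \<open>From rank conditions on the matrix to multiplication by $L^2$\<close>

lemma gen_idealI: "q = (\<Sum>i<s. h i * G i) \<Longrightarrow> q \<in> gen_ideal s G"
  by (auto simp: gen_ideal_def)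

lemma gen_ideal_add: "p \<in> gen_ideal s G \<Longrightarrow> q \<in> gen_ideal s G \<Longrightarrow> p + q \<in> gen_ideal s G"
proof -
  assume "p \<in> gen_ideal s G" "q \<in> gen_ideal s G"
  then obtain h h' where "p = (\<Sum>i<s. h i * G i)" "q = (\<Sum>i<s. h' i * G i)"
    by (auto simp: gen_ideal_def)
  thus ?thesis by (intro gen_idealI[of _ "\<lambda>i. h i + h' i"]) (simp add: sum.distrib algebra_simps)
qed

lemma gen_ideal_mult: "p \<in> gen_ideal s G \<Longrightarrow> q * p \<in> gen_ideal s G"
proof -
  assume "p \<in> gen_ideal s G"
  then obtain h where "p = (\<Sum>i<s. h i * G i)" by (auto simp: gen_ideal_def)
  thus ?thesis by (intro gen_idealI[of _ "\<lambda>i. q * h i"]) (simp add: sum_distrib_left mult.assoc)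
qed

lemma gen_ideal_0: "0 \<in> gen_ideal s G"
  by (intro gen_idealI[of _ "\<lambda>i. 0"]) simp

lemma gen_ideal_sum: "(\<And>x. x \<in> A \<Longrightarrow> p x \<in> gen_ideal s G) \<Longrightarrow> sum p A \<in> gen_ideal s G"
  by (induction A rule: infinite_finite_induct) (auto intro: gen_ideal_add gen_ideal_0)

lemma gen_ideal_cong: "(\<And>i. i < s \<Longrightarrow> G i = G' i) \<Longrightarrow> gen_ideal s G = gen_ideal s G'"
  unfolding gen_ideal_def by auto

text \<open>Full row rank writes every form of degree \<open>j\<close> as an element of the ideal
  plus a multiple of \<open>G s\<close>; the block with index \<open>s\<close> is the
  preimage.\<close>

lemma surjective_if_rows_indep:
  fixes G :: "nat \<Rightarrow> 'a::field mpoly3"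
  assumes ind: "rows_indep (mons j) (cols s a j) (matr G)" and j: "2 \<le> j"
    and G: "\<And>i. i < s \<Longrightarrow> G i \<in> hom_part (int (a i))" and F: "G s \<in> hom_part (int 2)"
  shows "mult_surjective (gen_ideal s G) (G s) 2 (int j)"
  unfolding mult_surjective_def
proof
  fix g :: "'a mpoly3" assume g: "g \<in> hom_part (int j)"
  obtain v where v: "\<And>r. r \<in> mons j \<Longrightarrow> (\<Sum>t\<in>cols s a j. matr G r t * v t) = cf r g"
    using rows_indep_solve[OF finite_mons finite_cols ind, of "\<lambda>r. cf r g"] by blast
  define q where "q = (\<Sum>t\<in>cols s a j. const3 (v t) * (mon (snd t) * G (fst t)))"
  \<comment> \<open>All columns have degree \<open>j\<close>, so \<open>q\<close> and
    \<open>g\<close> need comparison only on \<open>mons j\<close>.\<close>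
  have "mon m * G i \<in> hom_part (int j)" if "(i, m) \<in> cols s a j" for i m
  proof (cases "i < s")
    case True
    hence "m \<in> mons (j - a i)" "a i \<le> j"
      using that by (auto simp: cols_def colset_def split: if_splits)
    thus ?thesis using hom_part_mult[OF hom_part_mon[of m "j - a i"] G[OF True]] by simp
  next
    case False
    hence "m \<in> mons (j - 2)" "i = s"
      using that by (auto simp: cols_def colset_def)
    thus ?thesis using hom_part_mult[OF hom_part_mon[of m "j - 2"] F] j by simp
  qed
  hence q: "q \<in> hom_part (int j)"
    unfolding q_def by (intro hom_part_sum hom_part_const_mult) auto
  have "q = g"
  proof (rule cf_eqI)
    fix r
    show "cf r q = cf r g"
    proof (cases "r \<in> mons j")
      case True
      thus ?thesis using v[OF True] by (simp add: q_def cf_sum matr_def mult.commute)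
    next
      case False
      thus ?thesis using q g by (metis hom_part_iff)
    qed
  qed
  define f where "f = (\<Sum>m\<in>mons (j - 2). const3 (v (s, m)) * mon m)"
  show "\<exists>f\<in>hom_part (int j - 2). g - G s * f \<in> gen_ideal s G"
  proof
    have "f \<in> hom_part (int (j - 2))"
      unfolding f_def by (intro hom_part_sum hom_part_const_mult hom_part_mon)
    thus "f \<in> hom_part (int j - 2)" using j by (simp add: of_nat_diff)
    show "g - G s * f \<in> gen_ideal s G"
    proof (rule gen_idealI)
      show "g - G s * f = (\<Sum>i<s. (\<Sum>m\<in>colset s a j i. const3 (v (i, m)) * mon m) * G i)"
        unfolding \<open>q = g\<close>[symmetric] q_def sum_cols f_def by (simp add: mult.commute)
    qed
  qed
qed

text \<open>With \<open>w \<noteq> 0\<close> the square has degree 2 in the outermost variable z and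
  a constant leading coefficient. Inverting that constant turns pseudo-division into division with a
  remainder of z-degree at most 1.\<close>

lemma divide_by_linform_square:
  fixes h :: "'a::field mpoly3"
  assumes w: "w \<noteq> 0" and h: "h \<in> hom_part (int d)"
  shows "\<exists>q r. h = linform u v w ^ 2 * q + r \<and> r \<in> hom_part (int d) \<and> (\<forall>m. snd (snd m) \<ge> 2 \<longrightarrow> cf m r = 0)"
proof -
  define F where "F = linform u v w ^ 2"
  have L: "linform u v w = [:[:[:0, u:], [:v:]:], [:[:w:]:]:]"
    by (simp add: linform_def const3_def varX_def varY_def varZ_def)
  have dF: "degree F = 2" unfolding F_def L using w by (subst degree_power_eq) auto
  have lF: "lead_coeff F = [:[:w ^ 2:]:]"
    unfolding F_def lead_coeff_power L using w by (simp add: power2_eq_square)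
  have F0: "F \<noteq> 0" using dF by auto
  define N where "N = Suc (degree h) - degree F"
  obtain q' r' where qr: "pseudo_divmod h F = (q', r')" by (cases "pseudo_divmod h F")
  from pseudo_divmod[OF F0 qr] have
    1: "smult (lead_coeff F ^ N) h = F * q' + r'" and 2: "r' = 0 \<or> degree r' < degree F"
    by (simp_all add: N_def)
  define c where "c = (w ^ 2) ^ N"
  have c: "c \<noteq> 0" using w by (simp add: c_def)
  have "smult (lead_coeff F ^ N) h = const3 c * h"
    by (simp add: lF const3_def poly_const_pow c_def)
  with 1 have eq: "const3 c * h = F * q' + r'" by simp
  have "h = const3 (inverse c) * (const3 c * h)"
    using c by (simp flip: mult.assoc const3_simps)
  hence h': "h = F * (const3 (inverse c) * q') + const3 (inverse c) * r'"
    unfolding eq by (simp add: algebra_simps)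
  have r': "cf m r' = 0" if "snd (snd m) \<ge> 2" for m
    using that 2 dF by (cases m) (auto simp: cf_def coeff3_def coeff_eq_0)
  have F: "F \<in> hom_part (int 2)"
    unfolding F_def by (intro hom_part_power hom_part_linform)
  \<comment> \<open>Passing to degree \<open>d\<close> makes the remainder homogeneous without
    raising its z-degree.\<close>
  have "h = hom_comp d h" using h by (simp add: hom_comp_id)
  also have "\<dots> = hom_comp d (F * (const3 (inverse c) * q')) + hom_comp d (const3 (inverse c) * r')"
    by (subst h') (simp add: hom_comp_add)
  also have "\<dots> = F * (if 2 \<le> d then hom_comp (d - 2) (const3 (inverse c) * q') else 0) + hom_comp d (const3 (inverse c) * r')"
    by (simp add: hom_comp_mult[OF F])
  finally show ?thesis
    unfolding F_def using r' by (intro exI conjI) (auto simp: hom_comp_hom_part cf_hom_comp)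
qed

text \<open>Dividing the multipliers \<open>h i\<close> by $L^2$ leaves remainders supported on the
  column monomials; independence kills them, and the quotients exhibit \<open>f\<close> in the
  ideal.\<close>

lemma injective_if_cols_indep:
  fixes G :: "nat \<Rightarrow> 'a::field mpoly3"
  assumes ind: "rows_indep (cols s a j) (mons j) (\<lambda>t r. matr G r t)" and j: "2 \<le> j"
    and G: "\<And>i. i < s \<Longrightarrow> G i \<in> hom_part (int (a i))"
    and L: "G s = linform u v w ^ 2" and w: "w \<noteq> 0"
  shows "mult_injective (gen_ideal s G) (G s) 2 (int j)"
  unfolding mult_injective_def
proof (intro ballI impI)
  fix f assume "f \<in> hom_part (int j - 2)" and I: "G s * f \<in> gen_ideal s G"
  hence f: "f \<in> hom_part (int (j - 2))" using j by (simp add: of_nat_diff)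
  have F: "G s \<in> hom_part (int 2)"
    unfolding L by (intro hom_part_power hom_part_linform)
  have F0: "G s \<noteq> 0" using w by (auto simp: L linform_def const3_def varX_def varY_def varZ_def)
  from I obtain h where h: "G s * f = (\<Sum>i<s. h i * G i)" by (auto simp: gen_ideal_def)
  have "\<exists>q r. hom_comp (j - a i) (h i) = G s * q + r \<and> r \<in> hom_part (int (j - a i)) \<and> (\<forall>m. snd (snd m) \<ge> 2 \<longrightarrow> cf m r = 0)" for i
    unfolding L using w hom_comp_hom_part by (rule divide_by_linform_square)
  then obtain q r where qr: "\<And>i. hom_comp (j - a i) (h i) = G s * q i + r i"
    "\<And>i. r i \<in> hom_part (int (j - a i))" "\<And>i m. snd (snd m) \<ge> 2 \<Longrightarrow> cf m (r i) = 0"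
    by metis
  \<comment> \<open>Generators of degree above \<open>j\<close> contribute nothing in degree
    \<open>j\<close>; this also discards the indices where \<open>j - a i\<close> is
    truncated.\<close>
  define A where "A = {i. i < s \<and> a i \<le> j}"
  have A: "finite A" "A \<subseteq> {..<s}" by (auto simp: A_def)
  have "hom_comp j (G s * f) = G s * f"
    using hom_part_mult[OF F f] j by (intro hom_comp_id) simp
  hence "G s * f = (\<Sum>i<s. hom_comp j (G i * h i))"
    using h by (simp add: hom_comp_sum mult.commute)
  also have "\<dots> = (\<Sum>i<s. if a i \<le> j then G i * hom_comp (j - a i) (h i) else 0)"
    by (intro sum.cong refl hom_comp_mult G) auto
  also have "\<dots> = (\<Sum>i\<in>A. G i * hom_comp (j - a i) (h i))"
    by (rule sum.mono_neutral_cong_right) (auto simp: A_def)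
  also have "\<dots> = G s * (\<Sum>i\<in>A. q i * G i) + (\<Sum>i\<in>A. r i * G i)"
    by (simp add: qr(1) algebra_simps sum.distrib sum_distrib_left)
  finally have eq: "G s * f = G s * (\<Sum>i\<in>A. q i * G i) + (\<Sum>i\<in>A. r i * G i)" .
  define e where "e = f - (\<Sum>i\<in>A. q i * G i)"
  have e: "G s * e = (\<Sum>i\<in>A. r i * G i)"
    unfolding e_def using eq by (simp add: algebra_simps)
  have "hom_comp j (\<Sum>i\<in>A. r i * G i) = (\<Sum>i\<in>A. r i * G i)"
  proof (intro hom_comp_id hom_part_sum)
    fix i assume "i \<in> A"
    thus "r i * G i \<in> hom_part (int j)"
      using hom_part_mult[OF qr(2)[of i] G[of i]] by (simp add: A_def)
  qed
  \<comment> \<open>The quotients \<open>q i\<close> are not known to be homogeneous, so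
    \<open>e\<close> is replaced by its component of degree \<open>j - 2\<close>, which satisfies
    the same equation.\<close>
  hence e': "G s * hom_comp (j - 2) e = (\<Sum>i\<in>A. r i * G i)"
    using hom_comp_mult[OF F, of j e] j e by simp
  \<comment> \<open>Coefficients of the relation given by \<open>e'\<close>, with the $L^2$ block on
    the negative side.\<close>
  define v where "v t = (if fst t < s then cf (snd t) (r (fst t)) else - cf (snd t) (hom_comp (j - 2) e))" for t
  have rsum: "(\<Sum>m\<in>colset s a j i. const3 (v (i, m)) * mon m) = (if i \<in> A then r i else 0)" if "i < s" for i
  proof (cases "i \<in> A")
    case True
    have "(\<Sum>m\<in>colset s a j i. const3 (v (i, m)) * mon m) = hom_comp (j - a i) (r i)"
      unfolding hom_comp_def
    proof (rule sum.mono_neutral_cong_left)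
      show "\<forall>m\<in>mons (j - a i) - colset s a j i. const3 (cf m (r i)) * mon m = 0"
      proof
        fix m assume "m \<in> mons (j - a i) - colset s a j i"
        hence "2 \<le> snd (snd m)" using True by (auto simp: colset_def A_def)
        thus "const3 (cf m (r i)) * mon m = 0" by (simp add: qr(3))
      qed
    qed (use True that in \<open>auto simp: colset_def A_def v_def\<close>)
    thus ?thesis using True qr(2) by (simp add: hom_comp_id)
  next
    case False
    thus ?thesis using that by (simp add: A_def colset_def)
  qed
  have "(\<Sum>m\<in>mons (j - 2). const3 (v (s, m)) * mon m) = - hom_comp (j - 2) (hom_comp (j - 2) e)"
  proof -
    have "const3 (- x) = - const3 x" for x :: 'a
      by (simp add: const3_def)
    thus ?thesis by (simp add: hom_comp_def[of _ "hom_comp (j - 2) e"] v_def sum_negf)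
  qed
  hence esum: "(\<Sum>m\<in>mons (j - 2). const3 (v (s, m)) * mon m) = - hom_comp (j - 2) e"
    by (simp add: hom_comp_id hom_comp_hom_part)
  have "(\<Sum>t\<in>cols s a j. const3 (v t) * (mon (snd t) * G (fst t))) = (\<Sum>i\<in>A. r i * G i) - G s * hom_comp (j - 2) e"
  proof -
    have "(\<Sum>i<s. (\<Sum>m\<in>colset s a j i. const3 (v (i, m)) * mon m) * G i) = (\<Sum>i\<in>A. r i * G i)"
      by (rule sum.mono_neutral_cong_right) (use A rsum in auto)
    thus ?thesis unfolding sum_cols esum by (simp add: mult.commute)
  qed
  hence "(\<Sum>t\<in>cols s a j. const3 (v t) * (mon (snd t) * G (fst t))) = 0" using e' by simp
  hence "cf x (\<Sum>t\<in>cols s a j. const3 (v t) * (mon (snd t) * G (fst t))) = 0" for x by simp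
  hence "(\<Sum>t\<in>cols s a j. v t * matr G x t) = 0" for x
    by (simp add: cf_sum matr_def)
  from rows_indepD[OF ind this] have v0: "v t = 0" if "t \<in> cols s a j" for t using that by blast
  have "r i = 0" if "i \<in> A" for i
  proof -
    have "i < s" using that by (simp add: A_def)
    hence "(\<Sum>m\<in>colset s a j i. const3 (v (i, m)) * mon m) = 0"
      by (intro sum.neutral) (auto simp: v0 cols_def)
    thus ?thesis using rsum[OF \<open>i < s\<close>] that by simp
  qed
  hence "G s * e = 0" unfolding e by simp
  hence "f = (\<Sum>i\<in>A. q i * G i)" using F0 by (simp add: e_def)
  also have "\<dots> = (\<Sum>i<s. (if i \<in> A then q i else 0) * G i)"
    by (rule sum.mono_neutral_cong_left) (use A in auto)
  finally show "f \<in> gen_ideal s G" by (rule gen_idealI)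
qed

text \<open>Every monomial of degree \<open>j + 1\<close> is a variable times one of degree
  \<open>j\<close>, and the variable can be moved into the preimage.\<close>

lemma surjective_Suc:
  fixes F :: "'a::comm_ring_1 mpoly3"
  assumes surj: "mult_surjective (gen_ideal s G) F 2 (int j)" and j: "2 \<le> j"
  shows "mult_surjective (gen_ideal s G) F 2 (int (Suc j))"
  unfolding mult_surjective_def
proof
  fix g :: "'a mpoly3" assume g: "g \<in> hom_part (int (Suc j))"
  have "\<exists>f\<in>hom_part (int (j - 1)). mon m - F * f \<in> gen_ideal s G" if m: "m \<in> mons (Suc j)" for m
  proof -
    obtain v m' where v: "v \<in> mons 1" and m': "m' \<in> mons j" and eq: "mon m = mon v * (mon m' :: 'a mpoly3)"
    proof -
      obtain x y z where [simp]: "m = (x, y, z)" by (cases m)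
      consider x' where "x = Suc x'" | y' where "y = Suc y'" | z' where "z = Suc z'"
        using m by (cases x; cases y; cases z) auto
      thus ?thesis
      proof cases
        case 1
        thus ?thesis using that[of "(1, 0, 0)" "(x', y, z)"] m by (simp add: mon_mult)
      next
        case 2
        thus ?thesis using that[of "(0, 1, 0)" "(x, y', z)"] m by (simp add: mon_mult)
      next
        case 3
        thus ?thesis using that[of "(0, 0, 1)" "(x, y, z')"] m by (simp add: mon_mult)
      qed
    qed
    obtain f where f: "f \<in> hom_part (int j - 2)" "mon m' - F * f \<in> gen_ideal s G"
      using surj hom_part_mon[OF m'] unfolding mult_surjective_def by blast
    have "int j - 2 = int (j - 2)" using j by simp
    with f have "mon v * f \<in> hom_part (int (1 + (j - 2)))"
      using hom_part_mult[OF hom_part_mon[OF v]] by metis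
    moreover have "1 + (j - 2) = j - 1" using j by simp
    moreover have "mon m - F * (mon v * f) = mon v * (mon m' - F * f)"
      by (simp add: eq algebra_simps)
    ultimately show ?thesis using gen_ideal_mult[OF f(2)] by metis
  qed
  then obtain f where f: "\<And>m. m \<in> mons (Suc j) \<Longrightarrow> f m \<in> hom_part (int (j - 1))"
    "\<And>m. m \<in> mons (Suc j) \<Longrightarrow> mon m - F * f m \<in> gen_ideal s G" by metis
  show "\<exists>f\<in>hom_part (int (Suc j) - 2). g - F * f \<in> gen_ideal s G"
  proof
    have "int (Suc j) - 2 = int (j - 1)" using j by simp
    thus "(\<Sum>m\<in>mons (Suc j). const3 (cf m g) * f m) \<in> hom_part (int (Suc j) - 2)"
      by (simp only:) (intro hom_part_sum hom_part_const_mult f)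
    have "g - F * (\<Sum>m\<in>mons (Suc j). const3 (cf m g) * f m) = hom_comp (Suc j) g - F * (\<Sum>m\<in>mons (Suc j). const3 (cf m g) * f m)"
      using hom_comp_id[OF g] by simp
    also have "\<dots> = (\<Sum>m\<in>mons (Suc j). const3 (cf m g) * (mon m - F * f m))"
      by (simp add: hom_comp_def sum_subtractf sum_distrib_left algebra_simps)
    also have "\<dots> \<in> gen_ideal s G"
      using f by (intro gen_ideal_sum gen_ideal_mult)
    finally show "g - F * (\<Sum>m\<in>mons (Suc j). const3 (cf m g) * f m) \<in> gen_ideal s G" .
  qed
qed

section \<open>Polynomial dependence of the matrix on the linear forms\<close>

lemma poly_fun_cf_mult:
  assumes "\<And>m. (\<lambda>xs. cf m (p xs)) \<in> poly_fun n" "\<And>m. (\<lambda>xs. cf m (q xs)) \<in> poly_fun n"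
  shows "(\<lambda>xs. cf m (p xs * q xs)) \<in> poly_fun n"
proof -
  obtain i j k where m: "m = (i, j, k)" by (cases m)
  show ?thesis unfolding m cf_mult by (intro poly_fun_sum pf_mult assms)
qed

lemma poly_fun_cf_power:
  assumes "\<And>m. (\<lambda>xs. cf m (p xs)) \<in> poly_fun n"
  shows "(\<lambda>xs. cf m (p xs ^ k)) \<in> poly_fun n"
proof (induction k arbitrary: m)
  case 0
  show ?case by (simp add: pf_const)
next
  case (Suc k)
  show ?case unfolding power_Suc by (intro poly_fun_cf_mult assms Suc)
qed

lemma poly_fun_cf_lin_of:
  assumes "3 * i + 2 < n"
  shows "(\<lambda>xs. cf m (lin_of xs i)) \<in> poly_fun n"
  unfolding lin_of_def linform_mon cf_add cf_const_mult
  by (intro pf_add pf_mult pf_const pf_coord) (use assms in auto)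

definition gens :: "nat \<Rightarrow> (nat \<Rightarrow> nat) \<Rightarrow> 'a::comm_ring_1 list \<Rightarrow> nat \<Rightarrow> 'a mpoly3" where
  "gens s a xs i = lin_of xs i ^ (if i < s then a i else 2)"

lemma poly_fun_matr_gens:
  assumes "t \<in> cols s a j"
  shows "(\<lambda>xs. matr (gens s a xs) r t) \<in> poly_fun (3 * (s + 1))"
  unfolding matr_def gens_def using assms
  by (intro poly_fun_cf_mult pf_const poly_fun_cf_power poly_fun_cf_lin_of) (auto simp: cols_def)

section \<open>Dimension counts for $R$ and $R/L^2$\<close>

lemma card_low_z: "card {m \<in> mons d. snd (snd m) \<le> 1} = 2 * d + 1"
proof -
  have "{m \<in> mons d. snd (snd m) \<le> 1} = (\<lambda>i. (i, d - i, 0)) ` {..d} \<union> (\<lambda>i. (i, d - 1 - i, 1)) ` {..<d}"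
    by (auto simp: mons_def image_iff le_Suc_eq)
  also have "card \<dots> = card ((\<lambda>i. (i, d - i, 0::nat)) ` {..d}) + card ((\<lambda>i. (i, d - 1 - i, 1::nat)) ` {..<d})"
    by (rule card_Un_disjoint) auto
  also have "card ((\<lambda>i. (i, d - i, 0::nat)) ` {..d}) = d + 1"
    by (subst card_image) (auto simp: inj_on_def)
  also have "card ((\<lambda>i. (i, d - 1 - i, 1::nat)) ` {..<d}) = d"
    by (subst card_image) (auto simp: inj_on_def)
  finally show ?thesis by simp
qed

text \<open>Monomials divisible by $z^2$ correspond to those of degree \<open>j - 2\<close>; the
  others represent $[R/L^2]_j$.\<close>

lemma card_mons:
  assumes "2 \<le> j"
  shows "card (mons j) = 2 * j + 1 + card (mons (j - 2))"
proof -
  have "mons j = {m \<in> mons j. snd (snd m) \<le> 1} \<union> (\<lambda>(x, y, z). (x, y, z + 2)) ` mons (j - 2)" (is "_ = ?A \<union> ?B")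
  proof
    show "mons j \<subseteq> ?A \<union> ?B"
    proof
      fix m assume m: "m \<in> mons j"
      obtain x y z where [simp]: "m = (x, y, z)" by (cases m)
      show "m \<in> ?A \<union> ?B"
      proof (cases "z \<le> 1")
        case False
        hence "m = (\<lambda>(x, y, z). (x, y, z + 2)) (x, y, z - 2)" "(x, y, z - 2) \<in> mons (j - 2)"
          using m by auto
        thus ?thesis by blast
      qed (use m in auto)
    qed
  qed (use assms in \<open>auto simp: mons_def\<close>)
  hence "card (mons j) = card (?A \<union> ?B)" by simp
  also have "\<dots> = card ?A + card ?B"
    by (rule card_Un_disjoint) auto
  also have "card ?B = card (mons (j - 2))"
    by (rule card_image) (auto simp: inj_on_def)
  finally show ?thesis by (simp only: card_low_z)
qed

lemma card_cols:
  assumes "\<And>k. k < n \<Longrightarrow> a k \<le> j"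
  shows "card (cols n a j) = (\<Sum>k<n. 2 * (j - a k) + 1) + card (mons (j - 2))"
proof -
  have "card (cols n a j) = (\<Sum>k\<le>n. card (colset n a j k))"
    unfolding cols_def by (simp add: card_SigmaI)
  also have "\<dots> = (\<Sum>k<n. card (colset n a j k)) + card (colset n a j n)"
    unfolding lessThan_Suc_atMost[symmetric] by simp
  also have "(\<Sum>k<n. card (colset n a j k)) = (\<Sum>k<n. 2 * (j - a k) + 1)"
    by (rule sum.cong) (use assms card_low_z in \<open>auto simp: colset_def\<close>)
  also have "card (colset n a j n) = card (mons (j - 2))" by (simp add: colset_def)
  finally show ?thesis .
qed

text \<open>Ordering the forms by exponent lets those with $a_i \le j$ occupy the consecutive
points $0, \dots, n - 1$ for every $j$ at once, as the Vandermonde argument requires.\<close>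

definition rank_of :: "nat \<Rightarrow> (nat \<Rightarrow> nat) \<Rightarrow> nat \<Rightarrow> nat" where
  "rank_of s a i = card {k. k < s \<and> (a k < a i \<or> a k = a i \<and> k < i)}"

lemma rank_of_mono:
  assumes "i < s" "a i < a k \<or> a i = a k \<and> i < k"
  shows "rank_of s a i < rank_of s a k"
  unfolding rank_of_def
proof (rule psubset_card_mono)
  let ?B = "\<lambda>i. {k. k < s \<and> (a k < a i \<or> a k = a i \<and> k < i)}"
  have "?B i \<subseteq> ?B k" using assms by auto
  moreover have "i \<in> ?B k" "i \<notin> ?B i" using assms by auto
  ultimately show "?B i \<subset> ?B k" by blast
qed simp

text \<open>The set is closed under predecessors in the ordering, so ranks stay below its
  cardinality; an injection into a set of equal size is onto.\<close>

lemma bij_betw_rank_of: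
  "bij_betw (rank_of s a) {i. i < s \<and> a i \<le> j} {..<card {i. i < s \<and> a i \<le> j}}" (is "bij_betw _ ?A _")
proof -
  have inj: "inj_on (rank_of s a) ?A"
  proof (rule inj_onI)
    fix x y assume "x \<in> ?A" "y \<in> ?A" "rank_of s a x = rank_of s a y"
    thus "x = y" using rank_of_mono[of x s a y] rank_of_mono[of y s a x]
      by (auto simp: not_less) (metis linorder_cases order_less_irrefl)
  qed
  have "rank_of s a i < card ?A" if "i \<in> ?A" for i
    unfolding rank_of_def by (rule psubset_card_mono) (use that in auto)
  hence "rank_of s a ` ?A \<subseteq> {..<card ?A}" by auto
  hence "rank_of s a ` ?A = {..<card ?A}"
    by (intro card_subset_eq) (auto simp: card_image[OF inj])
  with inj show ?thesis by (simp add: bij_betw_def)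
qed

section \<open>Full rank at the special point\<close>

definition special_point :: "nat \<Rightarrow> (nat \<Rightarrow> nat) \<Rightarrow> 'a::comm_ring_1 list" where
  "special_point s a = map (\<lambda>p. let i = p div 3; c = p mod 3; k = rank_of s a i in
      if i < s then (if c = 0 then 1 else if c = 1 then 2 ^ k else 3 ^ k) else (if c = 2 then 1 else 0)) [0..<3 * (s + 1)]"

lemma special_point_nth:
  fixes s a
  defines "x0 \<equiv> special_point s a :: 'a::comm_ring_1 list"
  assumes "i \<le> s"
  shows "x0 ! (3 * i) = (if i < s then 1 else 0)"
    and "x0 ! (3 * i + 1) = (if i < s then 2 ^ rank_of s a i else 0)"
    and "x0 ! (3 * i + 2) = (if i < s then 3 ^ rank_of s a i else 1)"
proof -
  have *: "x0 ! p = (let i = p div 3; c = p mod 3; k = rank_of s a i in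
      if i < s then (if c = 0 then 1 else if c = 1 then 2 ^ k else 3 ^ k) else (if c = 2 then 1 else 0))"
    if "p < 3 * (s + 1)" for p
    using that unfolding x0_def special_point_def by (subst nth_map) (auto simp del: upt_Suc)
  have m: "(3 * i) div 3 = i" "(3 * i + 1) div 3 = i" "(3 * i + 2) div 3 = i"
    "(3 * i) mod 3 = 0" "(3 * i + 1) mod 3 = 1" "(3 * i + 2) mod 3 = 2"
    by presburger+
  have le: "3 * i < 3 * (s + 1)" "3 * i + 1 < 3 * (s + 1)" "3 * i + 2 < 3 * (s + 1)"
    using assms by auto
  show "x0 ! (3 * i) = (if i < s then 1 else 0)"
    unfolding *[OF le(1)] m Let_def by simp
  show "x0 ! (3 * i + 1) = (if i < s then 2 ^ rank_of s a i else 0)"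
    unfolding *[OF le(2)] m Let_def by simp
  show "x0 ! (3 * i + 2) = (if i < s then 3 ^ rank_of s a i else 1)"
    unfolding *[OF le(3)] m Let_def by simp
qed

lemma lin_of_special_point:
  fixes s a
  defines "x0 \<equiv> special_point s a :: 'a::comm_ring_1 list"
  shows "i < s \<Longrightarrow> lin_of x0 i = linform 1 (2 ^ rank_of s a i) (3 ^ rank_of s a i)"
    and "lin_of x0 s = linform 0 0 1"
  unfolding lin_of_def x0_def using special_point_nth[of i s a, where 'a = 'a] special_point_nth[of s s a, where 'a = 'a]
  by simp_all

text \<open>A vector in the left kernel of the matrix is a functional of the kind that
  \<open>special_pairing_eq_0\<close> shows to be zero.\<close>

lemma special_rows_indep:
  fixes G :: "nat \<Rightarrow> 'a::field_char_0 mpoly3"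
  assumes "2 \<le> j" "\<And>k. k < n \<Longrightarrow> a k \<le> j" "(\<Sum>k<n. 2 * (j - a k) + 1) \<ge> 2 * j + 1"
    and "\<And>k. k < n \<Longrightarrow> G k = linform 1 (2 ^ k) (3 ^ k) ^ a k" "G n = linform 0 0 1 ^ 2"
  shows "rows_indep (mons j) (cols n a j) (matr G)"
proof (rule rows_indepI)
  fix U m
  assume U: "\<And>t. t \<in> cols n a j \<Longrightarrow> (\<Sum>r\<in>mons j. U r * matr G r t) = 0" and m: "m \<in> mons j"
  have U': "pairing j U (mon m * G k) = 0" if "k \<le> n" "m \<in> colset n a j k" for k m
    using U[of "(k, m)"] that by (simp add: pairing_def matr_def cols_def)
  show "U m = 0"
  proof (rule special_pairing_eq_0[OF assms(1-3) _ _ m])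
    fix k m assume "k < n" "m \<in> mons (j - a k)" "snd (snd m) \<le> 1"
    thus "pairing j U (mon m * linform 1 (2 ^ k) (3 ^ k) ^ a k) = 0"
      using U'[of k m] assms(2,4) by (simp add: colset_def)
  next
    fix m assume "m \<in> mons (j - 2)"
    thus "pairing j U (mon m * linform 0 0 1 ^ 2) = 0"
      using U'[of n m] assms(5) by (simp add: colset_def)
  qed
qed

text \<open>The forms with exponent at most \<open>j\<close> are moved by rank to consecutive points
  and, if columns are missing, padded to a square matrix. The inequality in the second alternative
  allows it to be excluded in a suitable degree later.\<close>

lemma special_full_rank:
  fixes s a
  defines "M \<equiv> matr (gens s a (special_point s a :: 'a::field_char_0 list))"
  assumes j: "2 \<le> j"
  shows "rows_indep (mons j) (cols s a j) M \<or>
    (\<Sum>i | i < s \<and> a i \<le> j. 2 * (j - a i) + 1) < 2 * j + 1 \<and> rows_indep (cols s a j) (mons j) (\<lambda>t r. M r t)"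
proof -
  define A where "A = {i. i < s \<and> a i \<le> j}"
  define n where "n = card A"
  define \<sigma> where "\<sigma> = rank_of s a"
  have bij: "bij_betw \<sigma> A {..<n}"
    unfolding \<sigma>_def A_def n_def by (rule bij_betw_rank_of)
  hence inj: "inj_on \<sigma> A" and im: "\<sigma> ` A = {..<n}" by (auto simp: bij_betw_def)
  \<comment> \<open>Padding forms get exponent \<open>j\<close>, so that each of them has a single
    column: \<open>2 * (j - j) + 1 = 1\<close>.\<close>
  define b where "b k = (if k < n then a (the_inv_into A \<sigma> k) else j)" for k
  have b: "b (\<sigma> i) = a i" "\<sigma> i < n" if "i \<in> A" for i
    using that inj im by (auto simp: b_def the_inv_into_f_f)
  have bj: "b k \<le> j" for k
  proof (cases "k < n")
    case True
    then obtain i where "i \<in> A" "k = \<sigma> i" using im by blast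
    thus ?thesis using b by (simp add: A_def)
  qed (simp add: b_def)
  define S where "S = (\<Sum>i\<in>A. 2 * (j - a i) + 1)"
  have S: "(\<Sum>k<n. 2 * (j - b k) + 1) = S"
    unfolding S_def im[symmetric] by (simp add: sum.reindex[OF inj] b)
  \<comment> \<open>Truncated subtraction: no padding if \<open>S\<close> already reaches
    \<open>2 * j + 1\<close>, otherwise exactly the deficit.\<close>
  define n' where "n' = n + (2 * j + 1 - S)"
  have split: "{..<n'} = {..<n} \<union> {n..<n'}" by (auto simp: n'_def)
  have "(\<Sum>k<n'. 2 * (j - b k) + 1) = (\<Sum>k<n. 2 * (j - b k) + 1) + (\<Sum>k=n..<n'. 2 * (j - b k) + 1)"
    unfolding split by (rule sum.union_disjoint) auto
  also have "(\<Sum>k=n..<n'. 2 * (j - b k) + 1) = (\<Sum>k=n..<n'. 1)"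
    by (rule sum.cong) (auto simp: b_def)
  finally have S': "(\<Sum>k<n'. 2 * (j - b k) + 1) = S + (2 * j + 1 - S)"
    unfolding S by (simp add: n'_def)
  define G :: "nat \<Rightarrow> 'a mpoly3" where
    "G k = (if k < n' then linform 1 (2 ^ k) (3 ^ k) ^ b k else linform 0 0 1 ^ 2)" for k
  have rows: "rows_indep (mons j) (cols n' b j) (matr G)"
    by (rule special_rows_indep) (use j bj S' in \<open>auto simp: G_def\<close>)
  \<comment> \<open>Embeds the columns into those of the padded matrix; the block of $L^2$ moves
    from index \<open>s\<close> to \<open>n'\<close>.\<close>
  define \<pi> :: "nat \<times> nat \<times> nat \<times> nat \<Rightarrow> nat \<times> nat \<times> nat \<times> nat" where
    "\<pi> t = (if fst t < s then \<sigma> (fst t) else n', snd t)" for t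
  have nn: "n \<le> n'" by (simp add: n'_def)
  have colA: "(fst t < s \<and> fst t \<in> A \<and> \<sigma> (fst t) < n' \<and> b (\<sigma> (fst t)) = a (fst t)) \<or> fst t = s" if "t \<in> cols s a j" for t
  proof (cases "fst t < s")
    case True
    hence "fst t \<in> A" using that by (cases t) (auto simp: cols_def colset_def A_def split: if_splits)
    thus ?thesis using True b[of "fst t"] nn by auto
  next
    case False
    thus ?thesis using that by (auto simp: cols_def)
  qed
  have inj\<pi>: "inj_on \<pi> (cols s a j)"
  proof (rule inj_onI)
    fix t t' assume t: "t \<in> cols s a j" "t' \<in> cols s a j" "\<pi> t = \<pi> t'"
    hence "fst t = fst t'" using colA[OF t(1)] colA[OF t(2)] inj
      by (auto simp: \<pi>_def inj_on_def split: if_splits)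
    thus "t = t'" using t(3) by (simp add: \<pi>_def prod_eq_iff)
  qed
  have im\<pi>: "\<pi> t \<in> cols n' b j" if "t \<in> cols s a j" for t
    using colA[OF that] that by (cases t) (auto simp: \<pi>_def cols_def colset_def split: if_splits)
  have M\<pi>: "M r t = matr G r (\<pi> t)" if "t \<in> cols s a j" for r t
    using colA[OF that]
    by (auto simp: M_def matr_def gens_def \<pi>_def G_def lin_of_special_point \<sigma>_def)
  show ?thesis
  proof (cases "S \<ge> 2 * j + 1")
    case True
    hence n': "n' = n" by (simp add: n'_def)
    \<comment> \<open>Without padding, both matrices have the same columns up to renaming.\<close>
    have surj: "\<pi> ` cols s a j = cols n' b j"
    proof
      show "cols n' b j \<subseteq> \<pi> ` cols s a j"
      proof
        fix t assume t: "t \<in> cols n' b j"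
        show "t \<in> \<pi> ` cols s a j"
        proof (cases "fst t < n")
          case True
          then obtain i where i: "i \<in> A" "fst t = \<sigma> i" using im by blast
          hence "t = \<pi> (i, snd t)" by (simp add: \<pi>_def A_def prod_eq_iff)
          moreover have "(i, snd t) \<in> cols s a j"
            using t i b[OF i(1)] n' by (cases t) (auto simp: cols_def colset_def A_def)
          ultimately show ?thesis by blast
        next
          case False
          hence "t = \<pi> (s, snd t)" "(s, snd t) \<in> cols s a j"
            using t n' by (cases t; auto simp: \<pi>_def cols_def colset_def)+
          thus ?thesis by blast
        qed
      qed
    qed (use im\<pi> in auto)
    have "rows_indep (mons j) (cols s a j) M"
    proof (intro rows_indepI)
      fix u r assume u: "\<And>t. t \<in> cols s a j \<Longrightarrow> (\<Sum>r\<in>mons j. u r * M r t) = 0" and r: "r \<in> mons j"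
      have "(\<Sum>r\<in>mons j. u r * matr G r t) = 0" if t: "t \<in> cols n' b j" for t
      proof -
        obtain t0 where "t0 \<in> cols s a j" "t = \<pi> t0" using surj t by blast
        thus ?thesis using u M\<pi> by simp
      qed
      from rows_indepD[OF rows this r] show "u r = 0" .
    qed
    thus ?thesis ..
  next
    case False
    \<comment> \<open>The padded matrix is square, so its columns are independent, in particular
      those that come from \<open>M\<close>.\<close>
    hence "card (cols n' b j) \<le> card (mons j)"
      using card_cols[of n' b j] bj S' card_mons[OF j] by simp
    from rows_indep_transpose[OF finite_mons finite_cols rows this]
    have "rows_indep (cols s a j) (mons j) (\<lambda>t r. M r t)"
      by (rule rows_indep_subset[OF _ finite_cols inj\<pi>]) (use im\<pi> M\<pi> in auto)
    thus ?thesis using False by (auto simp: S_def A_def)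
  qed
qed

section \<open>Intersection of the finitely many open conditions\<close>

theorem theorem5p3:
  fixes s :: nat and a :: "nat \<Rightarrow> nat"
  assumes "s \<ge> 3" and "\<forall>i<s. 0 < a i"
  shows "\<exists>U :: 'a::field_char_0 list set.
           zariski_open (3 * (s + 1)) U \<and> U \<noteq> {} \<and>
           (\<forall>xs\<in>U. \<forall>j::int.
              max_rank_mult (gen_ideal s (\<lambda>i. lin_of xs i ^ a i)) ((lin_of xs s) ^ 2) 2 j)"
proof -
  define x0 where "x0 = (special_point s a :: 'a list)"
  define N where "N = 3 * (s + 1)"
  define J where "J = a 0 + a 1 + 2" \<comment> \<open>two forms already fill degree \<open>J\<close> modulo $L^2$\<close>
  \<comment> \<open>The clause \<open>j \<noteq> J\<close> forces surjectivity in degree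
    \<open>J\<close>, the starting point for all higher degrees.\<close>
  define good where "good j xs \<longleftrightarrow> rows_indep (mons j) (cols s a j) (matr (gens s a xs)) \<or>
    j \<noteq> J \<and> rows_indep (cols s a j) (mons j) (\<lambda>t r. matr (gens s a xs) r t)" for j and xs :: "'a list"
  have "\<exists>p\<in>poly_fun N. p x0 \<noteq> 0 \<and> (\<forall>xs. p xs \<noteq> 0 \<longrightarrow> good j xs)" if j: "2 \<le> j" for j
  proof -
    have pf: "(\<lambda>xs. matr (gens s a xs) r t) \<in> poly_fun N" if "t \<in> cols s a j" for r t
      unfolding N_def using that by (rule poly_fun_matr_gens)
    have "j \<noteq> J" if "(\<Sum>i | i < s \<and> a i \<le> j. 2 * (j - a i) + 1) < 2 * j + 1"
    proof
      assume J: "j = J"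
      \<comment> \<open>Forms 0 and 1 contribute \<open>2 * (a 0 + a 1) + 10\<close>, which exceeds
        \<open>2 * J + 1 = 2 * (a 0 + a 1) + 5\<close>.\<close>
      have "(\<Sum>i\<in>{0, 1}. 2 * (j - a i) + 1) \<le> (\<Sum>i | i < s \<and> a i \<le> j. 2 * (j - a i) + 1)"
        by (rule sum_mono2) (use assms(1) in \<open>auto simp: J J_def\<close>)
      with that show False by (simp add: J J_def)
    qed
    with special_full_rank[OF j, of s a, where 'a = 'a, folded x0_def]
    consider "rows_indep (mons j) (cols s a j) (matr (gens s a x0))"
      | "j \<noteq> J" "rows_indep (cols s a j) (mons j) (\<lambda>t r. matr (gens s a x0) r t)" by blast
    thus ?thesis
    proof cases
      case 1
      from rows_indep_open[OF finite_mons this pf] show ?thesis by (auto simp: good_def)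
    next
      case 2
      from rows_indep_open[where M = "\<lambda>xs t r. matr (gens s a xs) r t", OF finite_cols 2(2) pf]
      show ?thesis using 2(1) by (auto simp: good_def)
    qed
  qed
  then obtain p where p: "\<And>j. 2 \<le> j \<Longrightarrow> p j \<in> poly_fun N" "\<And>j. 2 \<le> j \<Longrightarrow> p j x0 \<noteq> 0"
    "\<And>j xs. 2 \<le> j \<Longrightarrow> p j xs \<noteq> 0 \<Longrightarrow> good j xs" by metis
  \<comment> \<open>The extra factor is the z-coefficient of $L$, which must be nonzero for the
    division by $L^2$.\<close>
  define P where "P xs = xs ! (3 * s + 2) * (\<Prod>j=2..J. p j xs)" for xs
  define U where "U = {xs. length xs = N \<and> P xs \<noteq> 0}"
  have "P \<in> poly_fun N"
    unfolding P_def by (intro pf_mult pf_coord poly_fun_prod p) (auto simp: N_def)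
  hence "zariski_open N U"
    unfolding zariski_open_def U_def by (intro exI[of _ "{P}"]) auto
  moreover have "x0 \<in> U"
  proof -
    have "length x0 = N" by (simp add: x0_def special_point_def N_def)
    moreover have "x0 ! (3 * s + 2) = 1"
      unfolding x0_def by (subst special_point_nth) simp_all
    ultimately show ?thesis using p(2) by (auto simp: U_def P_def)
  qed
  moreover have "max_rank_mult (gen_ideal s (\<lambda>i. lin_of xs i ^ a i)) (lin_of xs s ^ 2) 2 j"
    if xs: "xs \<in> U" for xs j
  proof -
    define G where "G = gens s a xs"
    define I where "I = gen_ideal s G"
    have I: "gen_ideal s (\<lambda>i. lin_of xs i ^ a i) = I"
      unfolding I_def by (rule gen_ideal_cong) (simp add: G_def gens_def)
    have F: "lin_of xs s ^ 2 = G s" by (simp add: G_def gens_def)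
    have w: "xs ! (3 * s + 2) \<noteq> 0" and good: "good j xs" if "2 \<le> j" "j \<le> J" for j
      using xs that p(3) by (auto simp: U_def P_def)
    have hom: "lin_of xs i \<in> hom_part (int 1)" for i
      unfolding lin_of_def by (rule hom_part_linform)
    have G: "G i \<in> hom_part (int (a i))" if "i < s" for i
      using hom_part_power[OF hom] that by (simp add: G_def gens_def)
    have Gs: "G s \<in> hom_part (int 2)" unfolding F[symmetric] by (rule hom_part_power[OF hom])
    have small: "mult_surjective I (G s) 2 (int j) \<or> j \<noteq> J \<and> mult_injective I (G s) 2 (int j)"
      if j: "2 \<le> j" "j \<le> J" for j
    proof -
      from good[OF j] consider "rows_indep (mons j) (cols s a j) (matr G)"
        | "j \<noteq> J" "rows_indep (cols s a j) (mons j) (\<lambda>t r. matr G r t)"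
        unfolding good_def G_def by blast
      thus ?thesis
      proof cases
        case 1
        from surjective_if_rows_indep[of j s a G, OF 1 j(1) G Gs] show ?thesis by (simp add: I_def)
      next
        case 2
        have "mult_injective (gen_ideal s G) (G s) 2 (int j)"
          using injective_if_cols_indep[of s a j G, OF 2(2) j(1) G _ w[OF j]]
          unfolding F[symmetric] lin_of_def by blast
        thus ?thesis using 2 by (simp add: I_def)
      qed
    qed
    \<comment> \<open>The product \<open>P\<close> controls only degrees up to \<open>J\<close>;
      beyond, surjectivity propagates.\<close>
    have large: "mult_surjective I (G s) 2 (int j)" if "J \<le> j" for j
      using that
    proof (induction j rule: dec_induct)
      case base
      show ?case using small[of J] by (simp add: J_def)
    next
      case (step j)
      thus ?case unfolding I_def using J_def by (intro surjective_Suc) auto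
    qed
    show ?thesis
    proof (cases "j \<ge> 2")
      case True
      hence j: "j = int (nat j)" "2 \<le> nat j" by auto
      have "mult_injective I (G s) 2 (int (nat j)) \<or> mult_surjective I (G s) 2 (int (nat j))"
        using small[OF j(2)] large[of "nat j"] by (cases "nat j \<le> J") auto
      thus ?thesis unfolding max_rank_mult_def I F by (simp only: j(1)[symmetric])
    next
      case False
      \<comment> \<open>For \<open>j < 2\<close> the source is zero, so the map is
        injective.\<close>
      have "f = 0" if "f \<in> hom_part (j - 2)" for f :: "'a mpoly3"
      proof (rule cf_eqI)
        fix m :: "nat \<times> nat \<times> nat"
        obtain x y z where m: "m = (x, y, z)" by (cases m)
        have "int (x + y + z) \<noteq> j - 2" using False by linarith
        thus "cf m f = cf m 0" using that by (auto simp: m cf_def hom_part_def coeff3_def)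
      qed
      thus ?thesis unfolding max_rank_mult_def mult_injective_def I F
        using gen_ideal_0[of s G] by (auto simp: I_def)
    qed
  qed
  ultimately show ?thesis unfolding N_def by blast
qed

end
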